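(* Let $\Omega\subset\mathbb{R}^n$ be compact and let $\mathcal{D}\in\mathbb{L}(\mathcal{M}(\Omega);C_0(\Omega))$ be defined by $\mathcal{D}\mu=\rho*\mu$, where $0\not\equiv\rho\in C_0(\mathbb{R}^n)$ satisfies $\rho(-y)=\rho(y)$ for all $y$ and $\mathcal{F}[\rho]\ge0$. Let $Y$ be a Hilbert space, $A\in\mathbb{L}(\mathcal{M}(\Omega);Y)$ pre-adjointable, $F_0:Y\to[-\infty,\infty]$ convex, proper and lower semicontinuous, $\alpha>0$, and $G(\mu)=\alpha\|\mu\|_{\mathcal{M}(\Omega)}+\delta_{\ge0}(\mu)$. Let $\bar u=(\bar\mu,\bar y)\in\mathcal{M}(\Omega)\times Y$ satisfy $0\in H(\bar u)$, where $$H(\mu,y):=\begin{pmatrix}\partial G(\mu)+A_*y\\ \partial F_0^*(y)-A\mu\end{pmatrix}.$$ Let $\{(\mu^k,y^k)\}_{k\ge1}$ be generated by the primal-dual method $\mu$PDPS (defined in the context) from some $u^0=(\mu^0,y^0)\in\mathcal{Z}(\Omega)\times Y$, with fractional tolerance $\kappa\in(0,1)$, step lengths $\tau,\sigma>0$ satisfying $\tau\sigma A_*A\le\mathcal{D}$, and the tolerance sequence $\{\epsilon_{k+1}\}_{k\in\mathbb{N}}\subset(0,\infty)$ satisfying $$\lim_{N\to\infty}\frac1N\sum_{k=0}^{N-1}\epsilon_{k+1}=0.$$ Let $\tilde u^N:=\frac1N\sum_{k=0}^{N-1}(\mu^{k+1},y^{k+1})$. Then $\mathcal{G}(\tilde u^N,\bar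 u)\to0$ as $N\to\infty$; more precisely, for all $N\ge1$, $$0\le\mathcal{G}(\tilde u^N,\bar u)\le\frac{1}{N\tau}\Bigl((\kappa+\|\bar\mu\|_{\mathcal{M}(\Omega)})\sum_{k=0}^{N-1}\epsilon_{k+1}+\frac12\|u^0-\bar u\|_{ZM}^2\Bigr).$$
   Context: All functions and measures are real-valued; $\mathbb{N}=\{0,1,2,\dots\}$. $\mathcal{M}(\Omega)$ is the space of finite Radon measures with the Radon (total variation) norm. $C_0(\Omega)$ (equal to $C(\Omega)$ for compact $\Omega$) is its designated predual, with dual product $\langle\phi|\mu\rangle=\int_\Omega\phi\,d\mu$. $\mathcal{Z}(\Omega)$ is the set of discrete measures (finite real combinations of Dirac measures at points of $\Omega$). $[\rho*\mu](x)=\int_\Omega\rho(x-y)\,d\mu(y)$; $\mathcal{F}$ is the Fourier transform (of tempered distributions where needed). $\delta_{\ge0}(\mu)$ equals $0$ if $\mu\ge0$ and $\infty$ otherwise. $\partial G(\mu)=\{\phi\in C_0(\Omega)\mid G(\nu)-G(\mu)\ge\langle\phi|\nu-\mu\rangle\ \forall\nu\in\mathcal{M}(\Omega)\}$ is the pre-subdifferential; $F_0^*$ is the Fenchel conjugate of $F_0$ on the Hilbert space $Y$ and $\partial F_0^*$ its convex subdifferential. $A$ is pre-adjointable if there is a pre-adjoint $A_*\in\mathbb{L}(Y;C_0(\Omega))$ with $\langle A_*y|\mu\rangle=\langle A\mu,y\rangle$ for all $y\in Y$, $\mu\in\mathcal{M}(\Omega)$. The inequality $\tau\sigma A_*A\le\mathcal{D}$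 means $\tau\sigma\langle A_*A\mu|\mu\rangle\le\langle\mathcal{D}\mu|\mu\rangle$ for all $\mu\in\mathcal{M}(\Omega)$. Method $\mu$PDPS: given $(\mu^0,y^0)$, for each $k\in\mathbb{N}$ let $v^k:=A_*y^k$, let $\mu^{k+1}\in\mathcal{Z}(\Omega)$, $\mu^{k+1}\ge0$, be computed so as to satisfy $$\tau[v^k+\alpha]+\mathcal{D}(\mu^{k+1}-\mu^k)\ge-\epsilon_{k+1}\ \text{ on }\Omega,$$ $$\tau[v^k+\alpha]+\mathcal{D}(\mu^{k+1}-\mu^k)\le\epsilon_{k+1}\ \text{ on }\operatorname{supp}\mu^{k+1},$$ $$\langle\tau[v^k+\alpha]+\mathcal{D}(\mu^{k+1}-\mu^k)|\mu^{k+1}\rangle\le\kappa\epsilon_{k+1},$$ and set $y^{k+1}:=\operatorname{prox}_{\sigma F_0^*}(y^k+\sigma A[2\mu^{k+1}-\mu^k])$, where $\operatorname{prox}_{\sigma F_0^*}(y)=\arg\min_{\tilde y\in Y}\bigl(\sigma F_0^*(\tilde y)+\frac12\|\tilde y-y\|_Y^2\bigr)$. The Lagrangian gap functional is, for $u=(\mu,y)$, $$\mathcal{G}(u,\bar u):=[G(\mu)-F_0^*(\bar y)+\langle A\mu,\bar y\rangle]-[G(\bar\mu)-F_0^*(y)+\langle A\bar\mu,y\rangle].$$ For $u=(\mu,y)\in\mathcal{M}(\Omega)\times Y$, $$\|u\|_{ZM}^2:=\langle\mathcal{D}\mu|\mu\rangle-2\tau\langle A\mu,y\rangle+\frac{\tau}{\sigma}\|y\|_Y^2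 .$$ *)

theory Defs
  imports "HOL-Analysis.Analysis"
begin

text \<open>
  A finite signed measure on the Borel sets of a Euclidean space is a countably additive real set
  function of finite total variation; all of these are Radon, the space being Polish. For the
  type to have extensional equality, set functions vanish off the Borel sets.
\<close>

definition variation_sums :: "('a::topological_space set \<Rightarrow> real) \<Rightarrow> real set" where
  "variation_sums m =
     {\<Sum>B\<in>P. \<bar>m B\<bar> | P. finite P \<and> P \<subseteq> sets borel \<and> disjoint P}"

definition signed_measure :: "('a::topological_space set \<Rightarrow> real) \<Rightarrow> bool" where
  "signed_measure m \<longleftrightarrow>
     (\<forall>B. B \<notin> sets borel \<longrightarrow> m B = 0) \<and>
     m {} = 0 \<and>
     (\<forall>B :: nat \<Rightarrow> 'a set. range B \<subseteq> sets borel \<longrightarrow> disjoint_family B \<longrightarrow>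
        (\<lambda>i. m (B i)) sums m (\<Union>i. B i)) \<and>
     bdd_above (variation_sums m)"

typedef (overloaded) 'a radon = "{m :: 'a::euclidean_space set \<Rightarrow> real. signed_measure m}"
  morphisms mass Radon
proof
  have "variation_sums (\<lambda>_::'a set. 0) \<subseteq> {0}"
    by (auto simp: variation_sums_def)
  then have "bdd_above (variation_sums (\<lambda>_::'a set. 0))"
    by (meson bdd_above_mono bdd_above_finite finite.emptyI finite.insertI)
  then show "(\<lambda>_. 0) \<in> {m :: 'a set \<Rightarrow> real. signed_measure m}"
    by (simp add: signed_measure_def)
qed

setup_lifting type_definition_radon

lemma variation_sums_nonempty: "variation_sums m \<noteq> {}"
  by (auto simp: variation_sums_def intro!: exI[of _ "{}"])

lemma variation_sumI:
  "finite P \<Longrightarrow> P \<subseteq> sets borel \<Longrightarrow> disjoint P \<Longrightarrow> (\<Sum>B\<in>P. \<bar>m B\<bar>) \<in> variation_sums m"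
  by (auto simp: variation_sums_def)

lemma variation_add_le:
  assumes "bdd_above (variation_sums m)" "bdd_above (variation_sums m')"
    and "x \<in> variation_sums (\<lambda>B. m B + m' B)"
  shows "x \<le> Sup (variation_sums m) + Sup (variation_sums m')"
proof -
  obtain P where P: "finite P" "P \<subseteq> sets borel" "disjoint P"
    and x: "x = (\<Sum>B\<in>P. \<bar>m B + m' B\<bar>)"
    using assms(3) by (auto simp: variation_sums_def)
  have "x \<le> (\<Sum>B\<in>P. \<bar>m B\<bar>) + (\<Sum>B\<in>P. \<bar>m' B\<bar>)"
    unfolding x sum.distrib[symmetric] by (intro sum_mono abs_triangle_ineq)
  also have "\<dots> \<le> Sup (variation_sums m) + Sup (variation_sums m')"
    using P assms by (intro add_mono cSup_upper variation_sumI)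
  finally show ?thesis .
qed

lemma variation_scale: "variation_sums (\<lambda>B. c * m B) = (\<lambda>x. \<bar>c\<bar> * x) ` variation_sums m"
proof -
  have "(\<Sum>B\<in>P. \<bar>c * m B\<bar>) = \<bar>c\<bar> * (\<Sum>B\<in>P. \<bar>m B\<bar>)" for P
    by (simp add: abs_mult sum_distrib_left)
  then show ?thesis unfolding variation_sums_def by auto
qed

lemma variation_scale_bdd:
  assumes "bdd_above (variation_sums m)"
  shows "bdd_above (variation_sums (\<lambda>B. c * m B))"
proof -
  obtain M where "\<forall>x\<in>variation_sums m. x \<le> M"
    using assms by (auto simp: bdd_above_def)
  then show ?thesis
    unfolding variation_scale by (intro bdd_aboveI[of _ "\<bar>c\<bar> * M"]) (auto intro: mult_left_mono)
qed

lemma signed_measure_bdd: "signed_measure m \<Longrightarrow> bdd_above (variation_sums m)"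
  unfolding signed_measure_def by (elim conjE)

lemma signed_measure_scale:
  fixes m :: "'a::topological_space set \<Rightarrow> real"
  assumes m: "signed_measure m"
  shows "signed_measure (\<lambda>B. c * m B)"
  unfolding signed_measure_def
proof (intro conjI allI impI)
  fix B :: "nat \<Rightarrow> 'a set"
  assume "range B \<subseteq> sets borel" "disjoint_family B"
  then have "(\<lambda>i. m (B i)) sums m (\<Union>i. B i)"
    using m unfolding signed_measure_def by blast
  then show "(\<lambda>i. c * m (B i)) sums (c * m (\<Union>i. B i))"
    by (rule sums_mult)
next
  show "bdd_above (variation_sums (\<lambda>B. c * m B))"
    by (rule variation_scale_bdd[OF signed_measure_bdd[OF m]])
next
  have "m {} = 0" using m unfolding signed_measure_def by blast
  then show "c * m {} = 0" by simp
next
  fix B :: "'a set" assume "B \<notin> sets borel"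
  then have "m B = 0" using m unfolding signed_measure_def by blast
  then show "c * m B = 0" by simp
qed

lemma signed_measure_add:
  fixes m m' :: "'a::topological_space set \<Rightarrow> real"
  assumes m: "signed_measure m" "signed_measure m'"
  shows "signed_measure (\<lambda>B. m B + m' B)"
  unfolding signed_measure_def
proof (intro conjI allI impI)
  fix B :: "nat \<Rightarrow> 'a set"
  assume "range B \<subseteq> sets borel" "disjoint_family B"
  then have "(\<lambda>i. m (B i)) sums m (\<Union>i. B i)" "(\<lambda>i. m' (B i)) sums m' (\<Union>i. B i)"
    using m unfolding signed_measure_def by blast+
  then show "(\<lambda>i. m (B i) + m' (B i)) sums (m (\<Union>i. B i) + m' (\<Union>i. B i))"
    by (rule sums_add)
next
  show "bdd_above (variation_sums (\<lambda>B. m B + m' B))"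
    by (rule bdd_aboveI, rule variation_add_le[OF m[THEN signed_measure_bdd]])
next
  have "m {} = 0" "m' {} = 0" using m unfolding signed_measure_def by blast+
  then show "m {} + m' {} = 0" by simp
next
  fix B :: "'a set" assume "B \<notin> sets borel"
  then have "m B = 0" "m' B = 0" using m unfolding signed_measure_def by blast+
  then show "m B + m' B = 0" by simp
qed

instantiation radon :: (euclidean_space) real_normed_vector
begin

lift_definition zero_radon :: "'a radon" is "\<lambda>_. 0"
  using signed_measure_scale[of "mass undefined" 0] mass[of undefined] by simp

lift_definition plus_radon :: "'a radon \<Rightarrow> 'a radon \<Rightarrow> 'a radon" is "\<lambda>m m' B. m B + m' B"
  by (rule signed_measure_add)

lift_definition scaleR_radon :: "real \<Rightarrow> 'a radon \<Rightarrow> 'a radon" is "\<lambda>c m B. c * m B"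
  by (rule signed_measure_scale)

definition uminus_radon :: "'a radon \<Rightarrow> 'a radon" where
  "- \<mu> = (-1) *\<^sub>R (\<mu> :: 'a radon)"

definition minus_radon :: "'a radon \<Rightarrow> 'a radon \<Rightarrow> 'a radon" where
  "(\<mu> :: 'a radon) - \<nu> = \<mu> + - \<nu>"

lift_definition norm_radon :: "'a radon \<Rightarrow> real" is "\<lambda>m. Sup (variation_sums m)" .

definition sgn_radon :: "'a radon \<Rightarrow> 'a radon" where
  "sgn \<mu> = inverse (norm \<mu>) *\<^sub>R (\<mu> :: 'a radon)"

definition dist_radon :: "'a radon \<Rightarrow> 'a radon \<Rightarrow> real" where
  "dist \<mu> \<nu> = norm (\<mu> - \<nu> :: 'a radon)"

definition uniformity_radon :: "('a radon \<times> 'a radon) filter" where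
  "uniformity_radon = (INF e\<in>{0<..}. principal {(\<mu>, \<nu>). dist \<mu> \<nu> < e})"

definition open_radon :: "'a radon set \<Rightarrow> bool" where
  "open_radon U \<longleftrightarrow> (\<forall>\<mu>\<in>U. \<forall>\<^sub>F (\<mu>', \<nu>) in uniformity. \<mu>' = \<mu> \<longrightarrow> \<nu> \<in> U)"

instance
proof
  fix \<mu> \<nu> \<xi> :: "'a radon" and a b :: real
  show "\<mu> + \<nu> + \<xi> = \<mu> + (\<nu> + \<xi>)" by transfer (simp add: algebra_simps)
  show "\<mu> + \<nu> = \<nu> + \<mu>" by transfer (simp add: algebra_simps)
  show "0 + \<mu> = \<mu>" by transfer simp
  show "- \<mu> + \<mu> = 0" unfolding uminus_radon_def by transfer simp
  show "\<mu> - \<nu> = \<mu> + - \<nu>" by (rule minus_radon_def)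
  show "a *\<^sub>R (\<mu> + \<nu>) = a *\<^sub>R \<mu> + a *\<^sub>R \<nu>" by transfer (simp add: algebra_simps)
  show "(a + b) *\<^sub>R \<mu> = a *\<^sub>R \<mu> + b *\<^sub>R \<mu>" by transfer (simp add: algebra_simps)
  show "a *\<^sub>R b *\<^sub>R \<mu> = (a * b) *\<^sub>R \<mu>" by transfer (simp add: algebra_simps)
  show "1 *\<^sub>R \<mu> = \<mu>" by transfer simp
  show "sgn \<mu> = inverse (norm \<mu>) *\<^sub>R \<mu>" by (rule sgn_radon_def)
  show "dist \<mu> \<nu> = norm (\<mu> - \<nu>)" by (rule dist_radon_def)
  show "uniformity = (INF e\<in>{0<..}. principal {(\<mu>::'a radon, \<nu>). dist \<mu> \<nu> < e})"
    by (rule uniformity_radon_def)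
  show "open U = (\<forall>\<mu>\<in>U. \<forall>\<^sub>F (\<mu>', \<nu>) in uniformity. \<mu>' = \<mu> \<longrightarrow> \<nu> \<in> U)"
    for U :: "'a radon set"
    by (rule open_radon_def)
  show "norm \<mu> = 0 \<longleftrightarrow> \<mu> = 0"
  proof
    assume "norm \<mu> = 0"
    then show "\<mu> = 0"
    proof transfer
      fix m :: "'a set \<Rightarrow> real"
      assume m: "signed_measure m" and n: "Sup (variation_sums m) = 0"
      have "m B = 0" for B
      proof (cases "B \<in> sets borel")
        case True
        then have "(\<Sum>C\<in>{B}. \<bar>m C\<bar>) \<in> variation_sums m"
          by (intro variation_sumI) (auto simp: disjoint_def)
        from cSup_upper[OF this signed_measure_bdd[OF m]]
        have "\<bar>m B\<bar> \<le> Sup (variation_sums m)" by simp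
        then show ?thesis using n by simp
      next
        case False
        then show ?thesis using m unfolding signed_measure_def by blast
      qed
      then show "m = (\<lambda>_. 0)" by blast
    qed
  next
    have "variation_sums (\<lambda>_::'a set. 0::real) = {0}"
      using variation_sums_nonempty[of "\<lambda>_::'a set. 0::real"] by (auto simp: variation_sums_def)
    then have "norm (0 :: 'a radon) = 0" by transfer simp
    then show "\<mu> = 0 \<Longrightarrow> norm \<mu> = 0" by simp
  qed
  show "norm (\<mu> + \<nu>) \<le> norm \<mu> + norm \<nu>"
  proof transfer
    fix m m' :: "'a set \<Rightarrow> real"
    assume "signed_measure m" "signed_measure m'"
    then show "Sup (variation_sums (\<lambda>B. m B + m' B)) \<le>
        Sup (variation_sums m) + Sup (variation_sums m')"
      by (intro cSup_least[OF variation_sums_nonempty] variation_add_le[OF signed_measure_bdd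
            signed_measure_bdd])
  qed
  show "norm (a *\<^sub>R \<mu>) = \<bar>a\<bar> * norm \<mu>"
  proof transfer
    fix a :: real and m :: "'a set \<Rightarrow> real"
    assume "signed_measure m"
    then have "bdd_above (variation_sums m)" by (rule signed_measure_bdd)
    moreover have "continuous (at_left (Sup (variation_sums m))) (\<lambda>x. \<bar>a\<bar> * x)"
      by (rule continuous_mult_left[OF continuous_ident])
    moreover have "mono (\<lambda>x. \<bar>a\<bar> * x)"
      by (intro monoI mult_left_mono) simp_all
    ultimately have "\<bar>a\<bar> * Sup (variation_sums m) = (SUP x\<in>variation_sums m. \<bar>a\<bar> * x)"
      by (intro continuous_at_Sup_mono variation_sums_nonempty)
    then show "Sup (variation_sums (\<lambda>B. a * m B)) = \<bar>a\<bar> * Sup (variation_sums m)"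
      by (simp add: variation_scale)
  qed
qed

end

lift_definition dirac :: "'a::euclidean_space \<Rightarrow> 'a radon" is
  "\<lambda>x B. if B \<in> sets borel \<and> x \<in> B then 1 else 0"
proof -
  fix x :: 'a
  let ?m = "\<lambda>B. if B \<in> sets borel \<and> x \<in> B then 1 else 0 :: real"
  have additive: "(\<lambda>i. ?m (B i)) sums ?m (\<Union>i. B i)"
    if B: "range B \<subseteq> sets borel" "disjoint_family B" for B :: "nat \<Rightarrow> 'a set"
  proof (cases "\<exists>j. x \<in> B j")
    case True
    then obtain j where j: "x \<in> B j" by blast
    then have "x \<notin> B i" if "i \<noteq> j" for i
      using B(2) that by (auto simp: disjoint_family_on_def)
    then have "(\<lambda>i. ?m (B i)) = (\<lambda>i. if i = j then 1 else 0)"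
      using B(1) j by (intro ext) auto
    then have "(\<lambda>i. ?m (B i)) sums 1"
      using sums_single[of j "\<lambda>_. 1 :: real"] by simp
    moreover have "?m (\<Union>i. B i) = 1"
      using B(1) j sets.countable_nat_UN[of B borel] by auto
    ultimately show ?thesis by simp
  next
    case False
    then show ?thesis by simp
  qed
  have bounded: "bdd_above (variation_sums ?m)"
  proof (rule bdd_aboveI)
    fix s assume "s \<in> variation_sums ?m"
    then obtain P where P: "finite P" "disjoint P" and s: "s = (\<Sum>B\<in>P. \<bar>?m B\<bar>)"
      by (auto simp: variation_sums_def)
    let ?Q = "{B \<in> P. x \<in> B}"
    have "card ?Q \<le> 1"
    proof -
      have "B = C" if "B \<in> ?Q" "C \<in> ?Q" for B C
        using P(2) that unfolding disjoint_def by blast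
      then show ?thesis
        using P(1) card_le_Suc0_iff_eq[of ?Q] by simp
    qed
    moreover have "s \<le> (\<Sum>B\<in>P. if x \<in> B then 1 else 0)"
      unfolding s by (intro sum_mono) auto
    moreover have "(\<Sum>B\<in>P. if x \<in> B then 1 else 0 :: real) = real (card ?Q)"
      using P(1) by (simp add: sum.If_cases Int_def)
    ultimately show "s \<le> 1" by linarith
  qed
  show "signed_measure ?m"
    unfolding signed_measure_def
  proof (intro conjI allI impI)
    show "?m B = 0" if "B \<notin> sets borel" for B
      using that by simp
  qed (simp, rule additive, assumption+, rule bounded)
qed

text \<open>
  \<open>M(\<Omega>)\<close> is the subspace of measures concentrated on \<open>\<Omega>\<close>; on it, integrals over the whole space are
  integrals over \<open>\<Omega>\<close>, and the total variation norms on \<open>\<Omega>\<close> and on the whole space agree.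
\<close>

definition radon_on :: "'a::euclidean_space set \<Rightarrow> 'a radon set" where
  "radon_on \<Omega> = {\<mu>. \<forall>B\<in>sets borel. B \<inter> \<Omega> = {} \<longrightarrow> mass \<mu> B = 0}"

definition discrete_on :: "'a::euclidean_space set \<Rightarrow> 'a radon set" where
  "discrete_on \<Omega> = span (dirac ` \<Omega>)"

definition nonneg :: "'a::euclidean_space radon \<Rightarrow> bool" where
  "nonneg \<mu> \<longleftrightarrow> (\<forall>B\<in>sets borel. 0 \<le> mass \<mu> B)"

definition supp :: "'a::euclidean_space radon \<Rightarrow> 'a set" where
  "supp \<mu> = {x. \<forall>U. open U \<and> x \<in> U \<longrightarrow> (\<exists>B\<in>sets borel. B \<subseteq> U \<and> mass \<mu> B \<noteq> 0)}"

text \<open>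
  Positive part in the Jordan decomposition; the negative part of \<open>\<mu>\<close> is the positive part of \<open>- \<mu>\<close>.
\<close>

definition pos_part :: "'a::euclidean_space radon \<Rightarrow> 'a measure" where
  "pos_part \<mu> = measure_of UNIV (sets borel)
     (\<lambda>B. ennreal (SUP C\<in>{C \<in> sets borel. C \<subseteq> B}. mass \<mu> C))"

definition dual_prod :: "('a::euclidean_space \<Rightarrow> real) \<Rightarrow> 'a radon \<Rightarrow> real" where
  "dual_prod \<phi> \<mu> = (LINT x|pos_part \<mu>. \<phi> x) - (LINT x|pos_part (- \<mu>). \<phi> x)"

text \<open>
  Elements of \<open>C\<^sub>0(\<Omega>)\<close> are represented by their extension by zero to the whole space, so that
  equality in \<open>C\<^sub>0(\<Omega>)\<close> is equality of functions.
\<close>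

definition C0 :: "'a::euclidean_space set \<Rightarrow> ('a \<Rightarrow> real) set" where
  "C0 \<Omega> = {\<phi>. continuous_on \<Omega> \<phi> \<and>
     (\<forall>e>0. \<exists>K. compact K \<and> K \<subseteq> \<Omega> \<and> (\<forall>x\<in>\<Omega> - K. \<bar>\<phi> x\<bar> < e)) \<and>
     (\<forall>x. x \<notin> \<Omega> \<longrightarrow> \<phi> x = 0)}"

definition conv_on ::
  "'a::euclidean_space set \<Rightarrow> ('a \<Rightarrow> real) \<Rightarrow> 'a radon \<Rightarrow> 'a \<Rightarrow> real" where
  "conv_on \<Omega> \<rho> \<mu> = (\<lambda>x. if x \<in> \<Omega> then dual_prod (\<lambda>y. \<rho> (x - y)) \<mu> else 0)"

fun iter_deriv :: "'a::euclidean_space list \<Rightarrow> ('a \<Rightarrow> real) \<Rightarrow> 'a \<Rightarrow> real" where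
  "iter_deriv [] f = f"
| "iter_deriv (b # bs) f = (\<lambda>x. frechet_derivative (iter_deriv bs f) (at x) b)"

definition schwartz :: "('a::euclidean_space \<Rightarrow> real) \<Rightarrow> bool" where
  "schwartz f \<longleftrightarrow> (\<forall>bs. set bs \<subseteq> Basis \<longrightarrow>
     (\<forall>x. iter_deriv bs f differentiable (at x)) \<and>
     (\<forall>k::nat. bounded (range (\<lambda>x. norm x ^ k * iter_deriv bs f x))))"

definition fourier :: "('a::euclidean_space \<Rightarrow> real) \<Rightarrow> 'a \<Rightarrow> complex" where
  "fourier f \<xi> = (LINT x|lborel. cis (- 2 * pi * (\<xi> \<bullet> x)) * complex_of_real (f x))"

text \<open>
  For bounded continuous \<open>\<rho>\<close>, the Fourier transform is the tempered distribution
  \<open>\<phi> \<mapsto> \<integral> \<rho> (fourier \<phi>)\<close>; a distribution is nonnegative if it is so on nonnegative test functions.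
\<close>

definition fourier_distr :: "('a::euclidean_space \<Rightarrow> real) \<Rightarrow> ('a \<Rightarrow> real) \<Rightarrow> complex" where
  "fourier_distr \<rho> \<phi> = (LINT x|lborel. complex_of_real (\<rho> x) * fourier \<phi> x)"

definition fourier_nonneg :: "('a::euclidean_space \<Rightarrow> real) \<Rightarrow> bool" where
  "fourier_nonneg \<rho> \<longleftrightarrow> (\<forall>\<phi>. schwartz \<phi> \<and> (\<forall>x. 0 \<le> \<phi> x) \<longrightarrow>
     fourier_distr \<rho> \<phi> \<in> \<real> \<and> 0 \<le> Re (fourier_distr \<rho> \<phi>))"

definition bounded_linear_on ::
  "'b::real_normed_vector set \<Rightarrow> ('b \<Rightarrow> 'c::real_normed_vector) \<Rightarrow> bool" where
  "bounded_linear_on S f \<longleftrightarrow>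
     (\<forall>u\<in>S. \<forall>v\<in>S. f (u + v) = f u + f v) \<and>
     (\<forall>c. \<forall>u\<in>S. f (c *\<^sub>R u) = c *\<^sub>R f u) \<and>
     (\<exists>C. \<forall>u\<in>S. norm (f u) \<le> C * norm u)"

definition bounded_linear_C0 ::
  "'a::euclidean_space set \<Rightarrow> ('y::real_normed_vector \<Rightarrow> 'a \<Rightarrow> real) \<Rightarrow> bool" where
  "bounded_linear_C0 \<Omega> T \<longleftrightarrow>
     (\<forall>y. T y \<in> C0 \<Omega>) \<and>
     (\<forall>y z. T (y + z) = (\<lambda>x. T y x + T z x)) \<and>
     (\<forall>c y. T (c *\<^sub>R y) = (\<lambda>x. c * T y x)) \<and>
     (\<exists>C. \<forall>y. \<forall>x\<in>\<Omega>. \<bar>T y x\<bar> \<le> C * norm y)"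

text \<open>
  A pre-adjoint is unique, since the Dirac measures at points of \<open>\<Omega>\<close> determine it pointwise.
\<close>

definition pre_adjoint ::
  "'a::euclidean_space set \<Rightarrow> ('a radon \<Rightarrow> 'y::real_inner) \<Rightarrow> ('y \<Rightarrow> 'a \<Rightarrow> real) \<Rightarrow> bool" where
  "pre_adjoint \<Omega> A As \<longleftrightarrow> bounded_linear_C0 \<Omega> As \<and>
     (\<forall>y. \<forall>\<mu>\<in>radon_on \<Omega>. dual_prod (As y) \<mu> = A \<mu> \<bullet> y)"

definition proper_fun :: "('y \<Rightarrow> ereal) \<Rightarrow> bool" where
  "proper_fun f \<longleftrightarrow> (\<forall>y. f y \<noteq> -\<infinity>) \<and> (\<exists>y. f y \<noteq> \<infinity>)"

definition convex_fun :: "('y::real_vector \<Rightarrow> ereal) \<Rightarrow> bool" where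
  "convex_fun f \<longleftrightarrow> convex {(y, r :: real). f y \<le> ereal r}"

definition lsc_fun :: "('y::topological_space \<Rightarrow> ereal) \<Rightarrow> bool" where
  "lsc_fun f \<longleftrightarrow> (\<forall>y. f y \<le> Liminf (at y) f)"

definition conjugate :: "('y::real_inner \<Rightarrow> ereal) \<Rightarrow> 'y \<Rightarrow> ereal" where
  "conjugate f y = (SUP z. ereal (y \<bullet> z) - f z)"

text \<open>
  The subgradient inequalities are in additive form because \<open>\<infinity> - \<infinity> = \<infinity>\<close> in \<open>ereal\<close>.
\<close>

definition subdiff :: "('y::real_inner \<Rightarrow> ereal) \<Rightarrow> 'y \<Rightarrow> 'y set" where
  "subdiff f y = {z. \<forall>y'. f y + ereal (z \<bullet> (y' - y)) \<le> f y'}"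

definition pre_subdiff ::
  "'a::euclidean_space set \<Rightarrow> ('a radon \<Rightarrow> ereal) \<Rightarrow> 'a radon \<Rightarrow> ('a \<Rightarrow> real) set" where
  "pre_subdiff \<Omega> G \<mu> =
     {\<phi> \<in> C0 \<Omega>. \<forall>\<nu>\<in>radon_on \<Omega>. G \<mu> + ereal (dual_prod \<phi> (\<nu> - \<mu>)) \<le> G \<nu>}"

definition prox :: "('y::real_inner \<Rightarrow> ereal) \<Rightarrow> 'y \<Rightarrow> 'y" where
  "prox f y = (ARG_MIN (\<lambda>z. f z + ereal ((norm (z - y))\<^sup>2 / 2)) z. True)"

definition G_reg :: "real \<Rightarrow> 'a::euclidean_space radon \<Rightarrow> ereal" where
  "G_reg \<alpha> \<mu> = ereal (\<alpha> * norm \<mu>) + (if nonneg \<mu> then 0 else \<infinity>)"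

definition H_op ::
  "'a::euclidean_space set \<Rightarrow> ('a radon \<Rightarrow> ereal) \<Rightarrow> ('y::real_inner \<Rightarrow> ereal) \<Rightarrow>
   ('a radon \<Rightarrow> 'y) \<Rightarrow> ('y \<Rightarrow> 'a \<Rightarrow> real) \<Rightarrow> 'a radon \<times> 'y \<Rightarrow> (('a \<Rightarrow> real) \<times> 'y) set" where
  "H_op \<Omega> G F A As = (\<lambda>(\<mu>, y).
     {(\<lambda>x. \<phi> x + As y x, z - A \<mu>) | \<phi> z. \<phi> \<in> pre_subdiff \<Omega> G \<mu> \<and> z \<in> subdiff F y})"

definition gap ::
  "('a::euclidean_space radon \<Rightarrow> ereal) \<Rightarrow> ('y::real_inner \<Rightarrow> ereal) \<Rightarrow> ('a radon \<Rightarrow> 'y) \<Rightarrow>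
   'a radon \<times> 'y \<Rightarrow> 'a radon \<times> 'y \<Rightarrow> ereal" where
  "gap G F A = (\<lambda>(\<mu>, y) (\<mu>', y').
     (G \<mu> - F y' + ereal (A \<mu> \<bullet> y')) - (G \<mu>' - F y + ereal (A \<mu>' \<bullet> y)))"

definition ZM_norm_sq ::
  "('a::euclidean_space radon \<Rightarrow> 'a \<Rightarrow> real) \<Rightarrow> ('a radon \<Rightarrow> 'y::real_inner) \<Rightarrow>
   real \<Rightarrow> real \<Rightarrow> 'a radon \<times> 'y \<Rightarrow> real" where
  "ZM_norm_sq D A \<tau> \<sigma> = (\<lambda>(\<mu>, y).
     dual_prod (D \<mu>) \<mu> - 2 * \<tau> * (A \<mu> \<bullet> y) + \<tau> / \<sigma> * (norm y)\<^sup>2)"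

definition mu_PDPS ::
  "'a::euclidean_space set \<Rightarrow> ('a radon \<Rightarrow> 'a \<Rightarrow> real) \<Rightarrow> ('a radon \<Rightarrow> 'y::real_inner) \<Rightarrow>
   ('y \<Rightarrow> 'a \<Rightarrow> real) \<Rightarrow> ('y \<Rightarrow> ereal) \<Rightarrow> real \<Rightarrow> real \<Rightarrow> real \<Rightarrow> real \<Rightarrow> (nat \<Rightarrow> real) \<Rightarrow>
   (nat \<Rightarrow> 'a radon) \<Rightarrow> (nat \<Rightarrow> 'y) \<Rightarrow> bool" where
  "mu_PDPS \<Omega> D A As F \<alpha> \<tau> \<sigma> \<kappa> \<epsilon> \<mu> y \<longleftrightarrow> (\<forall>k.
     let v = As (y k);
         g = (\<lambda>x. \<tau> * (v x + \<alpha>) + D (\<mu> (Suc k) - \<mu> k) x)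
     in \<mu> (Suc k) \<in> discrete_on \<Omega> \<and> nonneg (\<mu> (Suc k)) \<and>
        (\<forall>x\<in>\<Omega>. g x \<ge> - \<epsilon> (Suc k)) \<and>
        (\<forall>x\<in>supp (\<mu> (Suc k)). g x \<le> \<epsilon> (Suc k)) \<and>
        dual_prod g (\<mu> (Suc k)) \<le> \<kappa> * \<epsilon> (Suc k) \<and>
        y (Suc k) = prox (\<lambda>z. ereal \<sigma> * F z) (y k + \<sigma> *\<^sub>R A (2 *\<^sub>R \<mu> (Suc k) - \<mu> k)))"

end

theory Submission
  imports Defs
begin

text \<open>
  Pairing the optimality residual of the primal step with \<open>\<mu>\<^sup>k\<^sup>+\<^sup>1 - \<mu>bar\<close> costs at most
  \<open>(\<kappa> + \<parallel>\<mu>bar\<parallel>) \<epsilon>\<close>: against \<open>\<mu>\<^sup>k\<^sup>+\<^sup>1\<close> it gives at most \<open>\<kappa> \<epsilon>\<close>, and on \<open>\<Omega>\<close> it is at least \<open>- \<epsilon>\<close> while \<open>\<mu>bar \<ge> 0\<close>.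
  Adding the variational inequality of the proximal dual step, the coupling terms assemble into the
  inner product of \<open>u\<^sup>k\<^sup>+\<^sup>1 - u\<^sup>k\<close> and \<open>u\<^sup>k\<^sup>+\<^sup>1 - ubar\<close> for the ZM form. That form is symmetric by Fubini
  and evenness of \<open>\<rho>\<close>, and semidefinite by the step length condition, so the three-point identity
  telescopes; Jensen's inequality passes to the averages. Nonnegativity of the gap is the
  subgradient inequality at \<open>ubar\<close>.
\<close>

section \<open>The Jordan decomposition and the dual product\<close>

lemma mass_add: "mass (\<mu> + \<nu>) B = mass \<mu> B + mass \<nu> B"
  by (simp add: plus_radon.rep_eq)

lemma mass_scaleR: "mass (c *\<^sub>R \<mu>) B = c * mass \<mu> B"
  by (simp add: scaleR_radon.rep_eq)

lemma mass_zero: "mass 0 B = 0"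
  by (simp add: zero_radon.rep_eq)

lemma mass_uminus: "mass (- \<mu>) B = - mass \<mu> B"
  unfolding uminus_radon_def mass_scaleR by simp

lemma mass_empty: "mass \<mu> {} = 0"
  using mass[of \<mu>] by (simp add: signed_measure_def)

lemma mass_sums:
  "range B \<subseteq> sets borel \<Longrightarrow> disjoint_family B \<Longrightarrow> (\<lambda>i. mass \<mu> (B i)) sums mass \<mu> (\<Union>i. B i)"
  using mass[of \<mu>] unfolding signed_measure_def by blast

lemma bdd_above_variation_sums: "bdd_above (variation_sums (mass \<mu>))"
  using mass[of \<mu>] by (simp add: signed_measure_bdd)

lemma mass_Un:
  assumes "B \<in> sets borel" "C \<in> sets borel" "B \<inter> C = {}"
  shows "mass \<mu> (B \<union> C) = mass \<mu> B + mass \<mu> C"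
proof -
  have "disjoint_family (binaryset B C)"
    using assms(3) by (auto simp: disjoint_family_on_def binaryset_def)
  then have "(\<lambda>i. mass \<mu> (binaryset B C i)) sums mass \<mu> (\<Union>i. binaryset B C i)"
    using assms by (intro mass_sums) (auto simp: range_binaryset_eq)
  moreover have "(\<lambda>i. mass \<mu> (binaryset B C i)) sums (mass \<mu> B + mass \<mu> C)"
    by (rule binaryset_sums) (rule mass_empty)
  ultimately show ?thesis
    unfolding UN_binaryset_eq by (rule sums_unique2)
qed

lemma abs_mass_le_norm: "\<bar>mass \<mu> B\<bar> \<le> norm \<mu>"
proof (cases "B \<in> sets borel")
  case True
  then have "(\<Sum>C\<in>{B}. \<bar>mass \<mu> C\<bar>) \<in> variation_sums (mass \<mu>)"
    by (intro variation_sumI) (auto simp: disjoint_def)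
  from cSup_upper[OF this bdd_above_variation_sums] show ?thesis
    by (simp add: norm_radon.rep_eq)
next
  case False
  then have "mass \<mu> B = 0" using mass[of \<mu>] by (simp add: signed_measure_def)
  then show ?thesis by simp
qed

text \<open>The positive variation, that is, the set function inside \<open>measure_of\<close> in
  \<open>pos_part\<close>. It has its own name because \<open>measure_of\<close> takes these values
  only once countable additivity is known.\<close>

definition pos_mass :: "'a::euclidean_space radon \<Rightarrow> 'a set \<Rightarrow> real" where
  "pos_mass \<mu> B = (SUP C\<in>{C \<in> sets borel. C \<subseteq> B}. mass \<mu> C)"

lemma bdd_above_mass: "bdd_above (mass \<mu> ` S)"
  by (rule bdd_aboveI2) (rule order_trans[OF abs_ge_self abs_mass_le_norm])

lemma mass_le_pos_mass: "C \<in> sets borel \<Longrightarrow> C \<subseteq> B \<Longrightarrow> mass \<mu> C \<le> pos_mass \<mu> B"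
  unfolding pos_mass_def by (rule cSUP_upper[OF _ bdd_above_mass]) simp

lemma pos_mass_le:
  assumes "\<And>C. C \<in> sets borel \<Longrightarrow> C \<subseteq> B \<Longrightarrow> mass \<mu> C \<le> c"
  shows "pos_mass \<mu> B \<le> c"
  unfolding pos_mass_def
proof (rule cSUP_least)
  show "{C \<in> sets borel. C \<subseteq> B} \<noteq> {}" by (auto intro!: exI[of _ "{}"])
qed (use assms in auto)

lemma pos_mass_nonneg: "0 \<le> pos_mass \<mu> B"
  using mass_le_pos_mass[of "{}" B \<mu>] by (simp add: mass_empty)

lemma pos_mass_mono: "B \<subseteq> B' \<Longrightarrow> pos_mass \<mu> B \<le> pos_mass \<mu> B'"
  by (rule pos_mass_le) (auto intro: mass_le_pos_mass)

text \<open>A competitor inside \<open>B\<close> and one inside \<open>B'\<close> are disjoint, so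
  their union competes for \<open>B \<union> B'\<close>; the two suprema are then taken one after
  the other.\<close>

lemma pos_mass_superadditive:
  assumes "B \<inter> B' = {}"
  shows "pos_mass \<mu> B + pos_mass \<mu> B' \<le> pos_mass \<mu> (B \<union> B')"
proof -
  have "mass \<mu> C + mass \<mu> C' \<le> pos_mass \<mu> (B \<union> B')"
    if "C \<in> sets borel" "C \<subseteq> B" "C' \<in> sets borel" "C' \<subseteq> B'" for C C'
  proof -
    have "C \<inter> C' = {}" using assms that by blast
    then have "mass \<mu> C + mass \<mu> C' = mass \<mu> (C \<union> C')"
      using that by (simp add: mass_Un)
    also have "\<dots> \<le> pos_mass \<mu> (B \<union> B')"
      using that by (intro mass_le_pos_mass) auto
    finally show ?thesis .
  qed
  then have "mass \<mu> C \<le> pos_mass \<mu> (B \<union> B') - mass \<mu> C'"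
    if "C \<in> sets borel" "C \<subseteq> B" "C' \<in> sets borel" "C' \<subseteq> B'" for C C'
    using that by (simp add: le_diff_eq)
  then have "pos_mass \<mu> B \<le> pos_mass \<mu> (B \<union> B') - mass \<mu> C'"
    if "C' \<in> sets borel" "C' \<subseteq> B'" for C'
    using that by (intro pos_mass_le)
  then have "pos_mass \<mu> B' \<le> pos_mass \<mu> (B \<union> B') - pos_mass \<mu> B"
    by (intro pos_mass_le) (simp add: algebra_simps)
  then show ?thesis by simp
qed

text \<open>Superadditivity bounds the partial sums by the value on the whole union. Conversely, a
  competitor \<open>C\<close> for the union splits into pieces \<open>C \<inter> B i\<close>, each
  of which competes for \<open>B i\<close>.\<close>

lemma pos_mass_sums:
  fixes B :: "nat \<Rightarrow> 'a::euclidean_space set"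
  assumes B: "range B \<subseteq> sets borel" "disjoint_family B"
  shows "(\<lambda>i. pos_mass \<mu> (B i)) sums pos_mass \<mu> (\<Union>i. B i)"
proof -
  have "(\<Sum>i<n. pos_mass \<mu> (B i)) \<le> pos_mass \<mu> (\<Union>i<n. B i)" for n
  proof (induction n)
    case 0
    show ?case by (simp add: pos_mass_nonneg)
  next
    case (Suc n)
    have "B i \<inter> B n = {}" if "i < n" for i
      using that by (intro disjoint_family_onD[OF B(2)]) auto
    then have "(\<Union>i<n. B i) \<inter> B n = {}" by blast
    from pos_mass_superadditive[OF this, of \<mu>] Suc show ?case
      by (simp add: lessThan_Suc Un_commute)
  qed
  also have "pos_mass \<mu> (\<Union>i<n. B i) \<le> pos_mass \<mu> (\<Union>i. B i)" for n
    by (rule pos_mass_mono) auto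
  finally have partial: "(\<Sum>i<n. pos_mass \<mu> (B i)) \<le> pos_mass \<mu> (\<Union>i. B i)" for n .
  have summable: "summable (\<lambda>i. pos_mass \<mu> (B i))"
    by (rule summableI_nonneg_bounded[OF pos_mass_nonneg partial])
  have "suminf (\<lambda>i. pos_mass \<mu> (B i)) \<le> pos_mass \<mu> (\<Union>i. B i)"
    by (rule suminf_le_const[OF summable partial])
  moreover have "pos_mass \<mu> (\<Union>i. B i) \<le> suminf (\<lambda>i. pos_mass \<mu> (B i))"
  proof (rule pos_mass_le)
    fix C :: "'a set" assume C: "C \<in> sets borel" "C \<subseteq> (\<Union>i. B i)"
    have "disjoint_family (\<lambda>i. C \<inter> B i)"
      using B(2) by (auto simp: disjoint_family_on_def)
    then have "(\<lambda>i. mass \<mu> (C \<inter> B i)) sums mass \<mu> (\<Union>i. C \<inter> B i)"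
      using B(1) C(1) by (intro mass_sums) auto
    moreover have "(\<Union>i. C \<inter> B i) = C" using C(2) by blast
    ultimately have *: "(\<lambda>i. mass \<mu> (C \<inter> B i)) sums mass \<mu> C" by simp
    show "mass \<mu> C \<le> suminf (\<lambda>i. pos_mass \<mu> (B i))"
      unfolding sums_unique[OF *]
      by (rule suminf_le[OF _ sums_summable[OF *] summable])
        (use B(1) C(1) in \<open>auto intro!: mass_le_pos_mass\<close>)
  qed
  ultimately show ?thesis using summable by (simp add: sums_iff)
qed

lemma sets_pos_part [measurable_cong, simp]: "sets (pos_part \<mu>) = sets borel"
  unfolding pos_part_def using sets.sets_measure_of_eq[of borel] by simp

lemma space_pos_part [simp]: "space (pos_part \<mu>) = UNIV"
  unfolding pos_part_def by (simp add: space_measure_of_conv)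

lemma emeasure_pos_part:
  assumes "B \<in> sets borel"
  shows "emeasure (pos_part \<mu>) B = ennreal (pos_mass \<mu> B)"
proof -
  have "pos_mass \<mu> {} = 0"
    by (rule antisym[OF pos_mass_le pos_mass_nonneg]) (simp add: mass_empty)
  moreover have "countably_additive (sets borel) (\<lambda>B. ennreal (pos_mass \<mu> B))"
    unfolding countably_additive_def
    by (intro allI impI suminf_ennreal_eq[OF pos_mass_nonneg pos_mass_sums])
  moreover have "sigma_algebra UNIV (sets (borel :: 'a measure))"
    using sets.sigma_algebra_axioms[of "borel :: 'a measure"] by simp
  ultimately show ?thesis
    using assms unfolding pos_part_def
    by (subst emeasure_measure_of_sigma) (auto simp: positive_def pos_mass_def)
qed

lemma finite_measure_pos_part: "finite_measure (pos_part \<mu>)"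
  by (rule finite_measureI) (simp add: emeasure_pos_part)

lemma measure_pos_part: "B \<in> sets borel \<Longrightarrow> measure (pos_part \<mu>) B = pos_mass \<mu> B"
  by (simp add: measure_def emeasure_pos_part pos_mass_nonneg)

text \<open>The Jordan decomposition without a Hahn set: for \<open>C \<subseteq> B\<close>,
  \<open>mass \<mu> C\<close> is \<open>mass \<mu> B\<close> plus the mass of \<open>B - C\<close>
  under \<open>- \<mu>\<close>. Suprema give one inequality, and the same argument for
  \<open>- \<mu>\<close> gives the other.\<close>

lemma mass_eq_pos_mass_diff:
  assumes B: "B \<in> sets borel"
  shows "mass \<mu> B = pos_mass \<mu> B - pos_mass (- \<mu>) B"
proof -
  have *: "pos_mass \<mu> B \<le> mass \<mu> B + pos_mass (- \<mu>) B" for \<mu> :: "'a radon"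
  proof (rule pos_mass_le)
    fix C :: "'a set" assume C: "C \<in> sets borel" "C \<subseteq> B"
    have "mass \<mu> (C \<union> (B - C)) = mass \<mu> C + mass \<mu> (B - C)"
      using B C by (intro mass_Un) auto
    moreover have "C \<union> (B - C) = B" using C by blast
    moreover have "mass (- \<mu>) (B - C) \<le> pos_mass (- \<mu>) B"
      using B C by (intro mass_le_pos_mass) auto
    ultimately show "mass \<mu> C \<le> mass \<mu> B + pos_mass (- \<mu>) B"
      by (simp add: mass_uminus)
  qed
  from *[of \<mu>] *[of "- \<mu>"] show ?thesis by (simp add: mass_uminus)
qed

text \<open>Such functions are integrable against both Jordan parts, these being finite measures.
  Continuity would ask too much: extensions by zero from \<open>\<Omega>\<close> may jump at its
  boundary.\<close>

definition bdd_borel :: "('a::topological_space \<Rightarrow> real) \<Rightarrow> bool" where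
  "bdd_borel \<phi> \<longleftrightarrow> \<phi> \<in> borel_measurable borel \<and> (\<exists>c. \<forall>x. \<bar>\<phi> x\<bar> \<le> c)"

lemma bdd_borelI: "\<phi> \<in> borel_measurable borel \<Longrightarrow> (\<And>x. \<bar>\<phi> x\<bar> \<le> c) \<Longrightarrow> bdd_borel \<phi>"
  by (auto simp: bdd_borel_def)

lemma bdd_borel_measurable: "bdd_borel \<phi> \<Longrightarrow> \<phi> \<in> borel_measurable borel"
  by (simp add: bdd_borel_def)

lemma bdd_borel_const: "bdd_borel (\<lambda>_. c)"
  by (rule bdd_borelI[of _ "\<bar>c\<bar>"]) auto

lemma bdd_borel_add:
  assumes "bdd_borel \<phi>" "bdd_borel \<psi>"
  shows "bdd_borel (\<lambda>x. \<phi> x + \<psi> x)"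
proof -
  obtain a b where "\<And>x. \<bar>\<phi> x\<bar> \<le> a" "\<And>x. \<bar>\<psi> x\<bar> \<le> b"
    using assms by (auto simp: bdd_borel_def)
  then have "\<bar>\<phi> x + \<psi> x\<bar> \<le> a + b" for x
    by (meson abs_triangle_ineq add_mono order_trans)
  then show ?thesis
    using assms by (intro bdd_borelI[of _ "a + b"]) (auto simp: bdd_borel_def)
qed

lemma bdd_borel_cmult:
  assumes "bdd_borel \<phi>"
  shows "bdd_borel (\<lambda>x. c * \<phi> x)"
proof -
  obtain a where "\<And>x. \<bar>\<phi> x\<bar> \<le> a"
    using assms by (auto simp: bdd_borel_def)
  then have "\<bar>c * \<phi> x\<bar> \<le> \<bar>c\<bar> * a" for x
    by (simp add: abs_mult mult_left_mono)
  then show ?thesis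
    using assms by (intro bdd_borelI[of _ "\<bar>c\<bar> * a"]) (auto simp: bdd_borel_def)
qed

section \<open>Bilinearity of the dual product\<close>

lemma integrable_pos_part: "bdd_borel \<phi> \<Longrightarrow> integrable (pos_part \<mu>) \<phi>"
  unfolding bdd_borel_def
  by (elim conjE exE, rule finite_measure.integrable_const_bound[OF finite_measure_pos_part]) auto

lemma dual_prod_add_left:
  "bdd_borel \<phi> \<Longrightarrow> bdd_borel \<psi> \<Longrightarrow>
    dual_prod (\<lambda>x. \<phi> x + \<psi> x) \<mu> = dual_prod \<phi> \<mu> + dual_prod \<psi> \<mu>"
  unfolding dual_prod_def by (simp add: integrable_pos_part)

lemma dual_prod_cmult_left: "dual_prod (\<lambda>x. c * \<phi> x) \<mu> = c * dual_prod \<phi> \<mu>"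
  unfolding dual_prod_def by (simp add: algebra_simps)

lemma dual_prod_diff_left:
  "bdd_borel \<phi> \<Longrightarrow> bdd_borel \<psi> \<Longrightarrow>
    dual_prod (\<lambda>x. \<phi> x - \<psi> x) \<mu> = dual_prod \<phi> \<mu> - dual_prod \<psi> \<mu>"
  unfolding dual_prod_def by (simp add: integrable_pos_part)

lemma dual_prod_indicator: "B \<in> sets borel \<Longrightarrow> dual_prod (indicator B) \<mu> = mass \<mu> B"
  unfolding dual_prod_def by (simp add: measure_pos_part mass_eq_pos_mass_diff)

lemma dual_prod_const: "dual_prod (\<lambda>_. c) \<mu> = c * mass \<mu> UNIV"
proof -
  have "(\<lambda>_. 1) = (indicator UNIV :: 'a \<Rightarrow> real)" by auto
  then have "dual_prod (\<lambda>_. 1) \<mu> = mass \<mu> UNIV"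
    using dual_prod_indicator[of UNIV \<mu>] by simp
  then show ?thesis using dual_prod_cmult_left[of c "\<lambda>_. 1" \<mu>] by simp
qed

lemma tendsto_dual_prod:
  assumes "\<And>i. U i \<in> borel_measurable borel" "\<phi> \<in> borel_measurable borel"
    and "\<And>i x. \<bar>U i x\<bar> \<le> c" "\<And>x. (\<lambda>i. U i x) \<longlonglongrightarrow> \<phi> x"
  shows "(\<lambda>i. dual_prod (U i) \<mu>) \<longlonglongrightarrow> dual_prod \<phi> \<mu>"
proof -
  have "(\<lambda>i. LINT x|pos_part \<nu>. U i x) \<longlonglongrightarrow> (LINT x|pos_part \<nu>. \<phi> x)" for \<nu> :: "'a radon"
    by (rule integral_dominated_convergence[where w = "\<lambda>_. c"])
      (use assms in \<open>auto intro: integrable_pos_part[OF bdd_borel_const]\<close>)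
  then show ?thesis unfolding dual_prod_def by (intro tendsto_diff)
qed

text \<open>The positive part is not additive in the measure, so integrals against Jordan parts
  cannot simply be added. The claim is instead checked on indicators, where the dual product is
  \<open>mass\<close>, and carried to nonnegative bounded functions by induction.\<close>

lemma dual_prod_linear:
  assumes "bdd_borel \<phi>"
  shows "dual_prod \<phi> (a *\<^sub>R \<mu> + b *\<^sub>R \<nu>) = a * dual_prod \<phi> \<mu> + b * dual_prod \<phi> \<nu>"
proof -
  \<comment> \<open>The bound \<open>c\<close> stays variable in the induction: scaling changes it,
    and at monotone limits it is the dominating constant.\<close>
  have nonneg_case: "dual_prod f (a *\<^sub>R \<mu> + b *\<^sub>R \<nu>) = a * dual_prod f \<mu> + b * dual_prod f \<nu>"
    if "f \<in> borel_measurable borel" "\<And>x. 0 \<le> f x" "\<forall>x. f x \<le> c" for f c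
    using that
  proof (induction f arbitrary: c rule: borel_measurable_induct_real)
    case (set B)
    then show ?case by (simp add: dual_prod_indicator mass_add mass_scaleR)
  next
    case (mult u r)
    show ?case
    \<comment> \<open>A bound on \<open>r * u x\<close> gives one on \<open>u x\<close> only for
      nonzero \<open>r\<close>.\<close>
    proof (cases "r = 0")
      case True
      then show ?thesis by (simp add: dual_prod_const)
    next
      case False
      with mult.hyps(1) mult.prems have "\<forall>x. u x \<le> c / r"
        by (simp add: field_simps)
      with mult.IH have "dual_prod u (a *\<^sub>R \<mu> + b *\<^sub>R \<nu>) = a * dual_prod u \<mu> + b * dual_prod u \<nu>"
        by blast
      then show ?thesis
        by (simp add: dual_prod_cmult_left algebra_simps)
    qed
  next
    case (add u v)
    have uv: "u x \<le> c" "v x \<le> c" for x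
      using add.hyps(2)[of x] add.hyps(4)[of x] spec[OF add.prems, of x] by linarith+
    then have "bdd_borel u" "bdd_borel v"
      using add.hyps by (auto intro!: bdd_borelI[of _ c])
    with add.IH(1)[of c] add.IH(2)[of c] uv show ?case
      by (simp add: dual_prod_add_left algebra_simps)
  next
    case (seq U)
    have U_le: "U i x \<le> f x" for i x
      using seq.hyps(3,4) by (intro incseq_le[of "\<lambda>i. U i x"]) (auto simp: incseq_def le_fun_def)
    then have U_c: "\<forall>x. U i x \<le> c" for i
      using seq.prems by (meson order_trans)
    have lim: "(\<lambda>i. dual_prod (U i) \<xi>) \<longlonglongrightarrow> dual_prod f \<xi>" for \<xi> :: "'a radon"
      using seq.hyps U_c
      by (intro tendsto_dual_prod[of U f c] borel_measurable_LIMSEQ_real[of borel U f]) auto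
    have "(\<lambda>i. dual_prod (U i) (a *\<^sub>R \<mu> + b *\<^sub>R \<nu>)) \<longlonglongrightarrow>
        a * dual_prod f \<mu> + b * dual_prod f \<nu>"
      using seq.IH[OF U_c] lim[of \<mu>] lim[of \<nu>] by (auto intro!: tendsto_intros)
    from LIMSEQ_unique[OF lim this] show ?case .
  qed
  obtain c where bound: "\<And>x. \<bar>\<phi> x\<bar> \<le> c" and meas: "\<phi> \<in> borel_measurable borel"
    using assms by (auto simp: bdd_borel_def)
  \<comment> \<open>Adding the constant \<open>c\<close> makes the function nonnegative; constants
    themselves are handled by \<open>dual_prod_const\<close>.\<close>
  have c: "0 \<le> \<phi> x + c" "\<phi> x + c \<le> 2 * c" for x
    using bound[of x] by linarith+
  have "dual_prod (\<lambda>x. \<phi> x + c) (a *\<^sub>R \<mu> + b *\<^sub>R \<nu>) =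
      a * dual_prod (\<lambda>x. \<phi> x + c) \<mu> + b * dual_prod (\<lambda>x. \<phi> x + c) \<nu>"
    using c meas by (intro nonneg_case[of _ "2 * c"]) auto
  then show ?thesis
    by (simp add: dual_prod_add_left assms bdd_borel_const dual_prod_const mass_add mass_scaleR
        algebra_simps)
qed

lemma dual_prod_diff_right:
  "bdd_borel \<phi> \<Longrightarrow> dual_prod \<phi> (\<mu> - \<nu>) = dual_prod \<phi> \<mu> - dual_prod \<phi> \<nu>"
  using dual_prod_linear[of \<phi> 1 \<mu> "-1" \<nu>] by simp

section \<open>Measures concentrated on \<open>\<Omega>\<close> and nonnegative measures\<close>

lemma AE_pos_part_radon_on:
  assumes \<mu>: "\<mu> \<in> radon_on \<Omega>" and \<Omega>: "\<Omega> \<in> sets borel"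
  shows "AE x in pos_part \<mu>. x \<in> \<Omega>"
proof -
  have "pos_mass \<mu> (- \<Omega>) = 0"
  proof (rule antisym[OF pos_mass_le pos_mass_nonneg])
    fix C :: "'a set" assume "C \<in> sets borel" "C \<subseteq> - \<Omega>"
    then have "mass \<mu> C = 0" using \<mu> unfolding radon_on_def by blast
    then show "mass \<mu> C \<le> 0" by simp
  qed
  moreover have "- \<Omega> \<in> sets borel" using \<Omega> by (simp add: borel_comp)
  ultimately have "- \<Omega> \<in> null_sets (pos_part \<mu>)"
    by (simp add: null_sets_def emeasure_pos_part)
  then show ?thesis by (rule AE_I') auto
qed

lemma subspace_radon_on: "subspace (radon_on \<Omega>)"
  by (simp add: subspace_def radon_on_def mass_zero mass_add mass_scaleR)

lemma discrete_on_subset_radon_on: "discrete_on \<Omega> \<subseteq> radon_on \<Omega>"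
  unfolding discrete_on_def
  by (rule span_minimal[OF _ subspace_radon_on]) (auto simp: radon_on_def dirac.rep_eq)

lemma dual_prod_cong_on:
  assumes \<mu>: "\<mu> \<in> radon_on \<Omega>" and \<Omega>: "\<Omega> \<in> sets borel"
    and "\<phi> \<in> borel_measurable borel" "\<psi> \<in> borel_measurable borel"
    and eq: "\<And>x. x \<in> \<Omega> \<Longrightarrow> \<phi> x = \<psi> x"
  shows "dual_prod \<phi> \<mu> = dual_prod \<psi> \<mu>"
proof -
  have "(LINT x|pos_part \<nu>. \<phi> x) = (LINT x|pos_part \<nu>. \<psi> x)" if "\<nu> \<in> radon_on \<Omega>" for \<nu>
    using AE_pos_part_radon_on[OF that \<Omega>] assms by (intro integral_cong_AE) auto
  from this[OF \<mu>] this[OF subspace_neg[OF subspace_radon_on \<mu>]] show ?thesis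
    by (simp add: dual_prod_def)
qed

lemma dual_prod_nonneg_measure:
  assumes "nonneg \<mu>"
  shows "dual_prod \<phi> \<mu> = (LINT x|pos_part \<mu>. \<phi> x)"
proof -
  have "pos_mass (- \<mu>) UNIV = 0"
    using assms
    by (intro antisym[OF pos_mass_le pos_mass_nonneg]) (simp add: nonneg_def mass_uminus)
  then have "AE x in pos_part (- \<mu>). False"
    by (intro AE_I[of _ _ UNIV]) (auto simp: emeasure_pos_part)
  then have "(LINT x|pos_part (- \<mu>). \<phi> x) = 0"
    by (intro integral_eq_zero_AE) auto
  then show ?thesis by (simp add: dual_prod_def)
qed

text \<open>Used to pair the bound \<open>- \<epsilon>\<close> on the residual with the nonnegative
  solution measure. A bound on \<open>\<Omega>\<close> suffices because its complement is a null set
  of \<open>pos_part \<mu>\<close>.\<close>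

lemma dual_prod_ge_on:
  assumes "nonneg \<mu>" "\<mu> \<in> radon_on \<Omega>" "\<Omega> \<in> sets borel" "bdd_borel \<phi>"
    and "\<And>x. x \<in> \<Omega> \<Longrightarrow> c \<le> \<phi> x"
  shows "c * mass \<mu> UNIV \<le> dual_prod \<phi> \<mu>"
proof -
  have "c * mass \<mu> UNIV = (LINT x|pos_part \<mu>. c)"
    using dual_prod_const[of c \<mu>] dual_prod_nonneg_measure[OF assms(1), of "\<lambda>_. c"] by presburger
  also have "\<dots> \<le> (LINT x|pos_part \<mu>. \<phi> x)"
    using assms AE_pos_part_radon_on[OF assms(2,3)]
    by (intro integral_mono_AE integrable_pos_part bdd_borel_const) auto
  finally show ?thesis
    by (simp add: dual_prod_nonneg_measure assms(1))
qed

text \<open>This turns \<open>G_reg\<close> into a linear functional on nonnegative measures. By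
  finite additivity every variation sum is the mass of a union, hence at most the total
  mass.\<close>

lemma norm_nonneg_measure:
  assumes \<mu>: "nonneg \<mu>"
  shows "norm \<mu> = mass \<mu> UNIV"
proof (rule antisym)
  have finite_additive: "mass \<mu> (\<Union>P) = (\<Sum>B\<in>P. mass \<mu> B)"
    if "finite P" "P \<subseteq> sets borel" "disjoint P" for P
    using that
  proof (induction P)
    case (insert B P)
    have "B \<inter> C = {}" if "C \<in> P" for C
      using insert.hyps(2) that by (intro disjointD[OF insert.prems(2)]) auto
    then have "B \<inter> \<Union>P = {}" by blast
    then have "mass \<mu> (B \<union> \<Union>P) = mass \<mu> B + mass \<mu> (\<Union>P)"
      using insert.prems(1) insert.hyps(1) by (intro mass_Un) auto
    moreover have "disjoint P"
      using disjoint_unionD2[of "{B}" P] insert.prems(2) by simp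
    then have "mass \<mu> (\<Union>P) = (\<Sum>B\<in>P. mass \<mu> B)"
      using insert.prems(1) by (intro insert.IH) auto
    ultimately show ?case using insert.hyps by simp
  qed (simp add: mass_empty)
  show "norm \<mu> \<le> mass \<mu> UNIV"
    unfolding norm_radon.rep_eq
  proof (rule cSup_least[OF variation_sums_nonempty])
    fix s assume "s \<in> variation_sums (mass \<mu>)"
    then obtain P where P: "finite P" "P \<subseteq> sets borel" "disjoint P"
      and s: "s = (\<Sum>B\<in>P. \<bar>mass \<mu> B\<bar>)"
      by (auto simp: variation_sums_def)
    have "s = mass \<mu> (\<Union>P)"
      unfolding s finite_additive[OF P]
      using P \<mu> by (intro sum.cong) (auto simp: nonneg_def)
    also have "\<dots> \<le> mass \<mu> (\<Union>P) + mass \<mu> (- \<Union>P)"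
      using P \<mu> by (simp add: nonneg_def borel_comp sets.finite_Union)
    also have "\<dots> = mass \<mu> UNIV"
      using P by (subst mass_Un[symmetric]) (auto simp: borel_comp sets.finite_Union)
    finally show "s \<le> mass \<mu> UNIV" .
  qed
  show "mass \<mu> UNIV \<le> norm \<mu>"
    using abs_mass_le_norm[of \<mu> UNIV] by simp
qed

lemma nonneg_scaleR: "nonneg \<mu> \<Longrightarrow> 0 \<le> c \<Longrightarrow> nonneg (c *\<^sub>R \<mu>)"
  by (simp add: nonneg_def mass_scaleR)

lemma nonneg_sum: "(\<And>i. i \<in> I \<Longrightarrow> nonneg (\<mu> i)) \<Longrightarrow> nonneg (\<Sum>i\<in>I. \<mu> i)"
  by (induction I rule: infinite_finite_induct) (auto simp: nonneg_def mass_add mass_zero)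

lemma G_reg_nonneg: "nonneg \<mu> \<Longrightarrow> G_reg \<alpha> \<mu> = ereal (\<alpha> * mass \<mu> UNIV)"
  by (simp add: G_reg_def norm_nonneg_measure)

text \<open>The modulus of \<open>\<phi>\<close> is below 1 off a compact \<open>K\<close> and
  bounded on \<open>K\<close> by compactness. Measurability comes from continuity on the closed set
  \<open>\<Omega>\<close> and vanishing outside it.\<close>

lemma bdd_borel_C0:
  assumes \<phi>: "\<phi> \<in> C0 \<Omega>" and \<Omega>: "closed \<Omega>"
  shows "bdd_borel \<phi>"
proof -
  have cont: "continuous_on \<Omega> \<phi>" and zero: "\<And>x. x \<notin> \<Omega> \<Longrightarrow> \<phi> x = 0"
    using \<phi> by (auto simp: C0_def)
  have "\<exists>K. compact K \<and> K \<subseteq> \<Omega> \<and> (\<forall>x\<in>\<Omega> - K. \<bar>\<phi> x\<bar> < 1)"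
    using \<phi> by (auto simp: C0_def)
  then obtain K where K: "compact K" "K \<subseteq> \<Omega>" "\<And>x. x \<in> \<Omega> - K \<Longrightarrow> \<bar>\<phi> x\<bar> < 1" by blast
  have "compact (\<phi> ` K)"
    using K cont by (intro compact_continuous_image) (auto intro: continuous_on_subset)
  then obtain c where c: "\<And>x. x \<in> K \<Longrightarrow> \<bar>\<phi> x\<bar> \<le> c"
    using compact_imp_bounded by (fastforce simp: bounded_iff)
  have "\<bar>\<phi> x\<bar> \<le> max 1 c" for x
    using K(3)[of x] c[of x] zero[of x] by (cases "x \<in> \<Omega>"; cases "x \<in> K") auto
  moreover have "\<phi> = (\<lambda>x. indicator \<Omega> x *\<^sub>R \<phi> x)"
    using zero by (auto simp: fun_eq_iff indicator_def)
  moreover have "(\<lambda>x. indicator \<Omega> x *\<^sub>R \<phi> x) \<in> borel_measurable borel"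
    using \<Omega> cont by (intro borel_measurable_continuous_on_indicator) auto
  ultimately show ?thesis by (metis bdd_borelI)
qed

section \<open>Bounded kernels and Fubini\<close>

lemma bdd_borel_integral_pos_part:
  fixes k :: "'a::euclidean_space \<Rightarrow> 'b::euclidean_space \<Rightarrow> real"
  assumes k: "case_prod k \<in> borel_measurable borel" and c: "\<And>x y. \<bar>k x y\<bar> \<le> c"
  shows "bdd_borel (\<lambda>x. LINT y|pos_part \<nu>. k x y)"
proof -
  interpret finite_measure "pos_part \<nu>" by (rule finite_measure_pos_part)
  have "case_prod k \<in> borel_measurable (borel \<Otimes>\<^sub>M pos_part \<nu>)"
    using k by (simp add: borel_prod[symmetric] cong: measurable_cong_sets sets_pair_measure_cong)
  then have "(\<lambda>x. LINT y|pos_part \<nu>. k x y) \<in> borel_measurable borel"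
    by (rule borel_measurable_lebesgue_integral)
  moreover have "\<bar>LINT y|pos_part \<nu>. k x y\<bar> \<le> (LINT y|pos_part \<nu>. c)" for x
  proof -
    have "k x \<in> borel_measurable borel"
      using measurable_compose[OF _ k, of "Pair x" borel] by simp
    then have "bdd_borel (k x)"
      using c by (rule bdd_borelI)
    then show ?thesis
      using c by (intro integral_abs_bound_integral integrable_pos_part bdd_borel_const) auto
  qed
  ultimately show ?thesis by (rule bdd_borelI)
qed

lemma bdd_borel_dual_prod:
  fixes k :: "'a::euclidean_space \<Rightarrow> 'b::euclidean_space \<Rightarrow> real"
  assumes k: "case_prod k \<in> borel_measurable borel" and c: "\<And>x y. \<bar>k x y\<bar> \<le> c"
  shows "bdd_borel (\<lambda>x. dual_prod (k x) \<mu>)"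
  unfolding dual_prod_def
  using bdd_borel_add[OF bdd_borel_integral_pos_part[OF assms]
      bdd_borel_cmult[OF bdd_borel_integral_pos_part[OF assms], of "-1"]]
  by simp

text \<open>Fubini for each of the four pairs of Jordan parts; a bounded kernel is integrable for
  their finite product measures.\<close>

lemma dual_prod_swap:
  fixes k :: "'a::euclidean_space \<Rightarrow> 'b::euclidean_space \<Rightarrow> real"
  assumes k: "case_prod k \<in> borel_measurable borel" and c: "\<And>x y. \<bar>k x y\<bar> \<le> c"
  shows "dual_prod (\<lambda>x. dual_prod (k x) \<mu>) \<nu> = dual_prod (\<lambda>y. dual_prod (\<lambda>x. k x y) \<nu>) \<mu>"
proof -
  have swap: "(LINT x|pos_part \<nu>. LINT y|pos_part \<mu>. k x y) =
      (LINT y|pos_part \<mu>. LINT x|pos_part \<nu>. k x y)"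
    for \<mu> :: "'b radon" and \<nu> :: "'a radon"
  proof -
    interpret P: finite_measure "pos_part \<mu>" by (rule finite_measure_pos_part)
    interpret Q: finite_measure "pos_part \<nu>" by (rule finite_measure_pos_part)
    interpret QP: pair_sigma_finite "pos_part \<nu>" "pos_part \<mu>" ..
    interpret finite_measure "pos_part \<nu> \<Otimes>\<^sub>M pos_part \<mu>"
      by (rule finite_measure_pair_measure[OF P.finite_measure_axioms Q.finite_measure_axioms])
    have "case_prod k \<in> borel_measurable (pos_part \<nu> \<Otimes>\<^sub>M pos_part \<mu>)"
      using k by (simp add: borel_prod[symmetric] cong: measurable_cong_sets sets_pair_measure_cong)
    then have "integrable (pos_part \<nu> \<Otimes>\<^sub>M pos_part \<mu>) (case_prod k)"
      using c by (intro integrable_const_bound[of _ c]) auto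
    from QP.Fubini_integral[OF this] show ?thesis by simp
  qed
  \<comment> \<open>With the transposed kernel measurable, the inner integrals in the other order
    are integrable too.\<close>
  have k': "(\<lambda>(y, x). k x y) \<in> borel_measurable borel"
    using k measurable_compose[of "\<lambda>p. (snd p, fst p)" borel borel "case_prod k" borel]
    by (simp add: case_prod_beta' borel_prod[symmetric])
  show ?thesis
    unfolding dual_prod_def
    using integrable_pos_part[OF bdd_borel_integral_pos_part[OF k c]]
      integrable_pos_part[OF bdd_borel_integral_pos_part[OF k' c]]
    by (simp add: swap)
qed

section \<open>The convolution operator\<close>

lemma translated_kernel:
  fixes \<rho> :: "'a::euclidean_space \<Rightarrow> real"
  assumes "\<rho> \<in> C0 UNIV"
  obtains c where "(\<lambda>(x, y). \<rho> (x - y)) \<in> borel_measurable borel" "\<And>x y. \<bar>\<rho> (x - y)\<bar> \<le> c"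
proof -
  have "bdd_borel \<rho>" using assms by (rule bdd_borel_C0) simp
  then obtain c where "\<rho> \<in> borel_measurable borel" "\<And>x. \<bar>\<rho> x\<bar> \<le> c"
    by (auto simp: bdd_borel_def)
  then show thesis
    using measurable_compose[of "\<lambda>p. fst p - snd p" borel borel \<rho> borel]
    by (intro that[of c]) (simp_all add: case_prod_beta' borel_prod[symmetric])
qed

lemma bdd_borel_conv_on:
  assumes "\<rho> \<in> C0 UNIV" "\<Omega> \<in> sets borel"
  shows "bdd_borel (conv_on \<Omega> \<rho> \<mu>)"
proof -
  obtain c where "(\<lambda>(x, y). \<rho> (x - y)) \<in> borel_measurable borel" "\<And>x y. \<bar>\<rho> (x - y)\<bar> \<le> c"
    using translated_kernel[OF assms(1)] by blast
  then have "bdd_borel (\<lambda>x. dual_prod (\<lambda>y. \<rho> (x - y)) \<mu>)"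
    by (rule bdd_borel_dual_prod)
  then obtain b where m: "(\<lambda>x. dual_prod (\<lambda>y. \<rho> (x - y)) \<mu>) \<in> borel_measurable borel"
    and b: "\<And>x. \<bar>dual_prod (\<lambda>y. \<rho> (x - y)) \<mu>\<bar> \<le> b"
    by (auto simp: bdd_borel_def)
  have "0 \<le> b" using b[of 0] by linarith
  with m b assms(2) show ?thesis
    unfolding conv_on_def by (intro bdd_borelI[of _ b]) auto
qed

lemma conv_on_linear:
  assumes "\<rho> \<in> C0 UNIV"
  shows "conv_on \<Omega> \<rho> (a *\<^sub>R \<mu> + b *\<^sub>R \<nu>) = (\<lambda>x. a * conv_on \<Omega> \<rho> \<mu> x + b * conv_on \<Omega> \<rho> \<nu> x)"
proof -
  have "bdd_borel (\<lambda>y. \<rho> (x - y))" for x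
  proof -
    obtain c where "\<rho> \<in> borel_measurable borel" "\<And>x. \<bar>\<rho> x\<bar> \<le> c"
      using bdd_borel_C0[OF assms] by (auto simp: bdd_borel_def)
    then show ?thesis by (intro bdd_borelI[of _ c]) auto
  qed
  then show ?thesis
    by (auto simp: conv_on_def dual_prod_linear)
qed

text \<open>The cutoff in \<open>conv_on\<close> is invisible to a measure concentrated on
  \<open>\<Omega>\<close>. Then \<open>dual_prod_swap\<close> exchanges the integrals, and evenness
  turns \<open>\<rho> (x - y)\<close> into \<open>\<rho> (y - x)\<close>.\<close>

lemma dual_prod_conv_on_commute:
  assumes \<rho>: "\<rho> \<in> C0 UNIV" and even: "\<And>x. \<rho> (- x) = \<rho> x" and \<Omega>: "\<Omega> \<in> sets borel"
    and \<mu>: "\<mu> \<in> radon_on \<Omega>" and \<nu>: "\<nu> \<in> radon_on \<Omega>"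
  shows "dual_prod (conv_on \<Omega> \<rho> \<mu>) \<nu> = dual_prod (conv_on \<Omega> \<rho> \<nu>) \<mu>"
proof -
  obtain c where c: "(\<lambda>(x, y). \<rho> (x - y)) \<in> borel_measurable borel" "\<And>x y. \<bar>\<rho> (x - y)\<bar> \<le> c"
    using translated_kernel[OF \<rho>] by blast
  have *: "dual_prod (conv_on \<Omega> \<rho> \<mu>) \<nu> = dual_prod (\<lambda>x. dual_prod (\<lambda>y. \<rho> (x - y)) \<mu>) \<nu>"
    if "\<nu> \<in> radon_on \<Omega>" for \<mu> \<nu>
    using bdd_borel_conv_on[OF \<rho> \<Omega>] bdd_borel_dual_prod[OF c]
    by (intro dual_prod_cong_on[OF that \<Omega>]) (auto simp: bdd_borel_measurable conv_on_def)
  have "\<rho> (x - y) = \<rho> (y - x)" for x y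
    using even[of "x - y"] by simp
  then have "(\<lambda>y. dual_prod (\<lambda>x. \<rho> (x - y)) \<nu>) = (\<lambda>y. dual_prod (\<lambda>x. \<rho> (y - x)) \<nu>)"
    by presburger
  then show ?thesis
    unfolding *[OF \<nu>] *[OF \<mu>] using dual_prod_swap[OF c, of \<mu> \<nu>] by simp
qed

section \<open>Convex conjugates and proximal points in Hilbert spaces\<close>

text \<open>
  Minimising \<open>f z + \<parallel>z - y\<parallel>\<^sup>2 / 2\<close> over the epigraph of \<open>f\<close> also covers nearest-point projection,
  where the epigraph is that of an indicator function.
\<close>

lemma closed_convex_minimizer_exists:
  fixes C :: "('y::{real_inner,complete_space} \<times> real) set"
  assumes C: "closed C" "convex C" "C \<noteq> {}"
    and bound: "\<And>z r. (z, r) \<in> C \<Longrightarrow> m \<le> r + (norm (z - y))\<^sup>2 / 2"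
  obtains p s where "(p, s) \<in> C"
    and "\<And>z r. (z, r) \<in> C \<Longrightarrow> s + (norm (p - y))\<^sup>2 / 2 \<le> r + (norm (z - y))\<^sup>2 / 2"
proof -
  define Q where "Q = (\<lambda>q :: 'y \<times> real. snd q + (norm (fst q - y))\<^sup>2 / 2)"
  define i where "i = Inf (Q ` C)"
  have below: "bdd_below (Q ` C)"
    by (rule bdd_belowI[of _ m]) (use bound in \<open>auto simp: Q_def\<close>)
  have i_le: "i \<le> Q q" if "q \<in> C" for q
    unfolding i_def by (rule cINF_lower[OF below that])
  have "\<exists>q\<in>C. Q q < i + inverse (real (Suc n))" for n
  proof -
    have "Inf (Q ` C) < i + inverse (real (Suc n))"
      unfolding i_def by simp
    then show ?thesis
      using C(3) below by (subst (asm) cINF_less_iff) auto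
  qed
  then obtain q where q: "\<And>n. q n \<in> C" "\<And>n. Q (q n) < i + inverse (real (Suc n))"
    by metis
  \<comment> \<open>The parallelogram law at the midpoint \<open>c\<close>: as \<open>Q c\<close> is
    at least the infimum \<open>i\<close>, almost minimal points have close first
    components.\<close>
  have midpoint: "(norm (fst a - fst b))\<^sup>2 \<le> 4 * Q a + 4 * Q b - 8 * i"
    if "a \<in> C" "b \<in> C" for a b
  proof -
    define c where "c = (1 / 2) *\<^sub>R a + (1 / 2) *\<^sub>R b"
    have "c \<in> C"
      unfolding c_def by (rule convexD[OF C(2) that]) auto
    then have "i \<le> Q c" by (rule i_le)
    moreover have "8 * Q c = 4 * Q a + 4 * Q b - (norm (fst a - fst b))\<^sup>2"
      unfolding Q_def c_def power2_norm_eq_inner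
      by (simp add: inner_diff inner_add inner_commute field_simps)
    ultimately show ?thesis by linarith
  qed
  have close: "(norm (fst (q j) - fst (q k)))\<^sup>2 < 8 * inverse (real (Suc n))"
    if "n \<le> j" "n \<le> k" for n j k
  proof -
    have "inverse (real (Suc j)) \<le> inverse (real (Suc n))"
      "inverse (real (Suc k)) \<le> inverse (real (Suc n))"
      using that by auto
    with midpoint[OF q(1) q(1), of j k] q(2)[of j] q(2)[of k] show ?thesis by linarith
  qed
  have "Cauchy (\<lambda>n. fst (q n))"
  proof (rule CauchyI)
    fix e :: real assume "0 < e"
    then have "0 < e\<^sup>2 / 8" by simp
    from reals_Archimedean[OF this]
    obtain n where n: "inverse (real (Suc n)) < e\<^sup>2 / 8" by blast
    have "norm (fst (q j) - fst (q k)) < e" if "n \<le> j" "n \<le> k" for j k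
      using close[OF that] n \<open>0 < e\<close> by (intro power_less_imp_less_base[of _ 2 e]) auto
    then show "\<exists>M. \<forall>j\<ge>M. \<forall>k\<ge>M. norm (fst (q j) - fst (q k)) < e" by blast
  qed
  then obtain p where p: "(\<lambda>n. fst (q n)) \<longlonglongrightarrow> p"
    using Cauchy_convergent convergent_def by blast
  \<comment> \<open>So far only the first components converge. The limit of the heights is recovered
    from that of \<open>Q (q n)\<close>, and closedness of \<open>C\<close> then gives a
    minimiser.\<close>
  have "(\<lambda>n. Q (q n)) \<longlonglongrightarrow> i"
  proof (rule tendsto_sandwich[OF _ _ tendsto_const])
    show "(\<lambda>n. i + inverse (real (Suc n))) \<longlonglongrightarrow> i"
      using tendsto_add[OF tendsto_const LIMSEQ_inverse_real_of_nat, of i] by simp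
  qed (use i_le q in \<open>auto intro!: eventuallyI less_imp_le\<close>)
  then have "(\<lambda>n. Q (q n) - (norm (fst (q n) - y))\<^sup>2 / 2) \<longlonglongrightarrow> i - (norm (p - y))\<^sup>2 / 2"
    using p by (intro tendsto_intros) auto
  then have "(\<lambda>n. snd (q n)) \<longlonglongrightarrow> i - (norm (p - y))\<^sup>2 / 2"
    by (simp add: Q_def)
  with p have "(\<lambda>n. (fst (q n), snd (q n))) \<longlonglongrightarrow> (p, i - (norm (p - y))\<^sup>2 / 2)"
    by (rule tendsto_Pair)
  then have "(p, i - (norm (p - y))\<^sup>2 / 2) \<in> C"
    by (rule closed_sequentially[OF C(1), rotated]) (simp add: q(1))
  with i_le show thesis
    by (intro that[of p "i - (norm (p - y))\<^sup>2 / 2"]) (auto simp: Q_def)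
qed

text \<open>Compare \<open>(p, s)\<close> with the point at fraction \<open>t\<close> of the segment
  towards \<open>(z, r)\<close>, divide by \<open>t\<close> and let \<open>t\<close> tend to zero;
  the quadratic term disappears.\<close>

lemma minimizer_variational_inequality:
  fixes C :: "('y::real_inner \<times> real) set"
  assumes C: "convex C" "(p, s) \<in> C" "(z, r) \<in> C"
    and min: "\<And>z r. (z, r) \<in> C \<Longrightarrow> s + (norm (p - y))\<^sup>2 / 2 \<le> r + (norm (z - y))\<^sup>2 / 2"
  shows "s + (y - p) \<bullet> (z - p) \<le> r"
proof -
  define d where "d = z - p"
  have "0 \<le> (r - s - (y - p) \<bullet> d) + t * ((norm d)\<^sup>2 / 2)" if t: "0 < t" "t < 1" for t
  proof -
    have "(1 - t) *\<^sub>R (p, s) + t *\<^sub>R (z, r) \<in> C"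
      using t by (intro convexD[OF C]) auto
    then have "(p + t *\<^sub>R d, s + t * (r - s)) \<in> C"
      by (simp add: d_def algebra_simps)
    from min[OF this]
    have "0 \<le> t * (r - s) + (norm (p + t *\<^sub>R d - y))\<^sup>2 / 2 - (norm (p - y))\<^sup>2 / 2"
      by simp
    also have "\<dots> = t * ((r - s - (y - p) \<bullet> d) + t * ((norm d)\<^sup>2 / 2))"
      unfolding power2_norm_eq_inner
      by (simp add: inner_diff inner_add inner_commute field_simps power2_eq_square)
    finally show ?thesis
      using t by (simp add: zero_le_mult_iff)
  qed
  then have "eventually (\<lambda>t. 0 \<le> (r - s - (y - p) \<bullet> d) + t * ((norm d)\<^sup>2 / 2)) (at_right 0)"
    unfolding eventually_at_right_field by (intro exI[of _ 1]) auto
  moreover have "((\<lambda>t. (r - s - (y - p) \<bullet> d) + t * ((norm d)\<^sup>2 / 2)) \<longlongrightarrow>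
      (r - s - (y - p) \<bullet> d) + 0 * ((norm d)\<^sup>2 / 2)) (at_right 0)"
    by (intro tendsto_intros)
  ultimately have "0 \<le> (r - s - (y - p) \<bullet> d) + 0 * ((norm d)\<^sup>2 / 2)"
    by (intro tendsto_lowerbound) auto
  then show ?thesis by (simp add: d_def)
qed

text \<open>If a limit of epigraph points lay strictly below the graph, some real \<open>c\<close>
  would lie strictly between its height and the function value: nearby values of \<open>f\<close>
  exceed \<open>c\<close>, while the heights are eventually below \<open>c\<close>.\<close>

lemma lsc_fun_closed_epigraph:
  fixes f :: "'y::metric_space \<Rightarrow> ereal"
  assumes "lsc_fun f"
  shows "closed {(z, r :: real). f z \<le> ereal r}"
  unfolding closed_sequential_limits
proof (intro allI impI)
  fix x :: "nat \<Rightarrow> 'y \<times> real" and l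
  assume "(\<forall>n. x n \<in> {(z, r). f z \<le> ereal r}) \<and> x \<longlonglongrightarrow> l"
  then have x: "\<And>n. f (fst (x n)) \<le> ereal (snd (x n))" and l: "x \<longlonglongrightarrow> l"
    by (auto simp: case_prod_beta')
  show "l \<in> {(z, r). f z \<le> ereal r}"
  proof (rule ccontr)
    assume "l \<notin> {(z, r). f z \<le> ereal r}"
    then have "ereal (snd l) < f (fst l)" by (auto simp: case_prod_beta')
    then obtain c where c: "snd l < c" "ereal c < f (fst l)"
      using ereal_dense2 by fastforce
    have "ereal c < Liminf (at (fst l)) f"
      using c(2) assms unfolding lsc_fun_def by (meson less_le_trans)
    then have "eventually (\<lambda>z. ereal c < f z) (at (fst l))"
      by (rule less_LiminfD)
    \<comment> \<open>The filter \<open>at\<close> omits the point itself, where \<open>c(2)\<close>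
      supplies the inequality; the sequence may well hit its limit.\<close>
    then have "eventually (\<lambda>z. ereal c < f z) (nhds (fst l))"
      using c(2) unfolding eventually_at_filter by (auto elim: eventually_mono)
    then have "eventually (\<lambda>n. ereal c < f (fst (x n))) sequentially"
      using tendsto_fst[OF l] by (rule eventually_compose_filterlim)
    moreover have "eventually (\<lambda>n. snd (x n) < c) sequentially"
      using order_tendstoD(2)[OF tendsto_snd[OF l] c(1)] .
    ultimately have "eventually (\<lambda>n. False) sequentially"
    proof eventually_elim
      case (elim n)
      then have "ereal c < ereal (snd (x n))" using x[of n] by (meson less_le_trans)
      with elim show False by simp
    qed
    then show False by simp
  qed
qed

text \<open>Replaces an extended-real supremum by real affine inequalities; points where
  \<open>f\<close> is infinite impose no condition.\<close>

lemma conjugate_le_iff: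
  assumes "proper_fun f"
  shows "conjugate f y \<le> ereal r \<longleftrightarrow> (\<forall>x a. f x = ereal a \<longrightarrow> y \<bullet> x - a \<le> r)"
proof -
  have "ereal (y \<bullet> x) - f x \<le> ereal r \<longleftrightarrow> (\<forall>a. f x = ereal a \<longrightarrow> y \<bullet> x - a \<le> r)" for x
    using assms by (cases "f x") (auto simp: proper_fun_def)
  then show ?thesis
    by (auto simp: conjugate_def SUP_le_iff)
qed

lemma proper_funE:
  assumes "proper_fun f"
  obtains x a where "f x = ereal a"
proof -
  obtain x where "f x \<noteq> \<infinity>" "f x \<noteq> -\<infinity>" using assms by (auto simp: proper_fun_def)
  then show thesis by (cases "f x") (auto intro: that)
qed

lemma conjugate_not_MInf:
  assumes "proper_fun f"
  shows "conjugate f y \<noteq> -\<infinity>"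
proof
  assume *: "conjugate f y = -\<infinity>"
  obtain x a where a: "f x = ereal a" using assms by (rule proper_funE)
  have "conjugate f y \<le> ereal (y \<bullet> x - a - 1)" by (simp add: *)
  then have "y \<bullet> x - a \<le> y \<bullet> x - a - 1" using a conjugate_le_iff[OF assms] by blast
  then show False by simp
qed

text \<open>
  Projecting a point strictly below the graph onto the epigraph yields a nonvertical supporting
  hyperplane, whose slope is a point where the conjugate is finite.
\<close>

lemma proper_conjugate:
  fixes f :: "'y::{real_inner,complete_space} \<Rightarrow> ereal"
  assumes f: "convex_fun f" "proper_fun f" "lsc_fun f"
  shows "proper_fun (conjugate f)"
proof -
  define E where "E = {(z, r :: real). f z \<le> ereal r}"
  obtain x a where a: "f x = ereal a" using f(2) by (rule proper_funE)
  have E: "closed E" "convex E" "(x, a) \<in> E"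
    using f a lsc_fun_closed_epigraph unfolding E_def convex_fun_def by auto
  define q where "q = (x, a - 1)"
  \<comment> \<open>All heights in \<open>E \<times> {0}\<close> are zero, so the minimised quantity
    is half the squared distance to \<open>q\<close> and \<open>P\<close> is the projection of
    \<open>q\<close> onto \<open>E\<close>.\<close>
  obtain P t where P: "(P, t) \<in> E \<times> {0}"
    and min: "\<And>z r. (z, r) \<in> E \<times> {0} \<Longrightarrow> t + (norm (P - q))\<^sup>2 / 2 \<le> r + (norm (z - q))\<^sup>2 / 2"
    by (rule closed_convex_minimizer_exists[of "E \<times> {0}" 0 q])
      (use E in \<open>auto intro: closed_Times convex_Times\<close>)
  have obtuse: "(q - P) \<bullet> (z - P) \<le> 0" if "z \<in> E" for z
    using minimizer_variational_inequality[OF _ P _ min, of z 0] that P E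
    by (auto intro: convex_Times)
  obtain p s where ps: "P = (p, s)" by (cases P)
  have pE: "(p, s) \<in> E" using P ps by simp
  have obtuse': "(x - p) \<bullet> (z - p) + (a - 1 - s) * (r - s) \<le> 0" if "(z, r) \<in> E" for z r
    using obtuse[OF that] by (simp add: q_def ps)
  define \<beta> where "\<beta> = s - (a - 1)"
  have "f p \<le> ereal (s + 1)"
    using pE by (auto simp: E_def intro: order_trans)
  \<comment> \<open>Moving vertically upwards stays in the epigraph, and the obtuse angle condition
    in this direction fixes the sign of \<open>\<beta>\<close>.\<close>
  then have "(p, s + 1) \<in> E" by (simp add: E_def)
  from obtuse'[OF this] have "0 \<le> \<beta>" by (simp add: \<beta>_def)
  \<comment> \<open>A vertical hyperplane is excluded by testing with the graph point
    \<open>(x, a)\<close>: it would force \<open>x = p\<close> and so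
    \<open>f x \<le> a - 1\<close>.\<close>
  moreover have "\<beta> \<noteq> 0"
  proof
    assume "\<beta> = 0"
    with obtuse'[OF E(3)] have "(x - p) \<bullet> (x - p) \<le> 0" by (simp add: \<beta>_def)
    then have "x = p"
      by (metis inner_gt_zero_iff not_less right_minus_eq)
    with pE a \<open>\<beta> = 0\<close> show False by (simp add: E_def \<beta>_def)
  qed
  ultimately have \<beta>: "0 < \<beta>" by simp
  define w where "w = (1 / \<beta>) *\<^sub>R (x - p)"
  have "conjugate f w \<le> ereal (w \<bullet> p - s)"
    unfolding conjugate_le_iff[OF f(2)]
  proof (intro allI impI)
    fix z b assume "f z = ereal b"
    then have "(z, b) \<in> E" by (simp add: E_def)
    from obtuse'[OF this] have "(x - p) \<bullet> (z - p) \<le> \<beta> * (b - s)"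
      by (simp add: \<beta>_def algebra_simps)
    then have "(1 / \<beta>) * ((x - p) \<bullet> (z - p)) \<le> b - s"
      using \<beta> by (simp add: field_simps)
    then show "w \<bullet> z - b \<le> w \<bullet> p - s"
      by (simp add: w_def inner_diff_right right_diff_distrib)
  qed
  then have "conjugate f w \<noteq> \<infinity>" by auto
  with conjugate_not_MInf[OF f(2)] show ?thesis by (auto simp: proper_fun_def)
qed

text \<open>Jensen's inequality: the conjugate is a supremum of affine functions, and each of these
  averages exactly.\<close>

lemma conjugate_average_le:
  assumes f: "proper_fun f" and N: "0 < N"
    and z: "\<And>k. k < N \<Longrightarrow> conjugate f (z k) \<le> ereal (s k)"
  shows "conjugate f ((1 / real N) *\<^sub>R (\<Sum>k<N. z k)) \<le> ereal ((1 / real N) * (\<Sum>k<N. s k))"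
  unfolding conjugate_le_iff[OF f]
proof (intro allI impI)
  fix x a assume "f x = ereal a"
  then have "(\<Sum>k<N. z k \<bullet> x - a) \<le> (\<Sum>k<N. s k)"
    using z conjugate_le_iff[OF f] by (intro sum_mono) auto
  then have "(1 / real N) * ((\<Sum>k<N. z k) \<bullet> x - real N * a) \<le> (1 / real N) * (\<Sum>k<N. s k)"
    by (intro mult_left_mono) (auto simp: sum_subtractf inner_sum_left)
  then show "((1 / real N) *\<^sub>R (\<Sum>k<N. z k)) \<bullet> x - a \<le> (1 / real N) * (\<Sum>k<N. s k)"
    using N by (simp add: right_diff_distrib)
qed

text \<open>Since \<open>prox\<close> selects by choice, a minimiser must be shown to exist before
  the selected point is known to minimise; the variational inequality then applies to it.\<close>

lemma prox_conjugate:
  fixes f :: "'y::{real_inner,complete_space} \<Rightarrow> ereal"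
  assumes f: "convex_fun f" "proper_fun f" "lsc_fun f" and \<sigma>: "0 < \<sigma>"
    and p_def: "p = prox (\<lambda>z. ereal \<sigma> * conjugate f z) y"
  obtains s where "conjugate f p = ereal s"
    and "\<And>z r. conjugate f z = ereal r \<Longrightarrow> \<sigma> * s + (y - p) \<bullet> (z - p) \<le> \<sigma> * r"
proof -
  define h where "h = (\<lambda>z. ereal \<sigma> * conjugate f z + ereal ((norm (z - y))\<^sup>2 / 2))"
  \<comment> \<open>The epigraph of \<open>\<sigma>\<close> times the conjugate. By
    \<open>C_eq\<close> it is an intersection of half-spaces, hence closed and convex.\<close>
  define C where "C = {(z, r). conjugate f z \<le> ereal (r / \<sigma>)}"
  have C_eq: "C = (\<Inter>(x, a)\<in>{(x, a). f x = ereal a}. {q. (x, - 1 / \<sigma>) \<bullet> q \<le> a})"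
    unfolding C_def conjugate_le_iff[OF f(2)] by (auto simp: inner_commute algebra_simps)
  have "closed C" "convex C"
    unfolding C_eq
    by (auto intro!: closed_INT convex_INT closed_halfspace_le convex_halfspace_le)
  obtain z0 r0 where r0: "conjugate f z0 = ereal r0"
    using proper_conjugate[OF f] by (rule proper_funE)
  then have "(z0, \<sigma> * r0) \<in> C" using \<sigma> by (simp add: C_def)
  obtain x a where a: "f x = ereal a" using f(2) by (rule proper_funE)
  \<comment> \<open>A single affine minorant of the conjugate bounds the objective below, by
    completing the square in \<open>z - y + \<sigma> *\<^sub>R x\<close>.\<close>
  have "\<sigma> * (y \<bullet> x) - \<sigma>\<^sup>2 * (norm x)\<^sup>2 / 2 - \<sigma> * a \<le> r + (norm (z - y))\<^sup>2 / 2" if "(z, r) \<in> C" for z r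
  proof -
    have "z \<bullet> x - a \<le> r / \<sigma>"
      using that a conjugate_le_iff[OF f(2)] by (auto simp: C_def)
    then have "\<sigma> * (z \<bullet> x) - \<sigma> * a \<le> r"
      using \<sigma> by (simp add: field_simps)
    moreover have "0 \<le> (norm (z - y + \<sigma> *\<^sub>R x))\<^sup>2 / 2" by simp
    then have "0 \<le> (norm (z - y))\<^sup>2 / 2 + \<sigma> * (z \<bullet> x) - \<sigma> * (y \<bullet> x) + \<sigma>\<^sup>2 * (norm x)\<^sup>2 / 2"
      unfolding power2_norm_eq_inner
      by (simp add: inner_diff inner_add inner_commute field_simps power2_eq_square)
    ultimately show ?thesis by linarith
  qed
  then obtain p0 s0 where p0: "(p0, s0) \<in> C"
    and min0: "\<And>z r. (z, r) \<in> C \<Longrightarrow> s0 + (norm (p0 - y))\<^sup>2 / 2 \<le> r + (norm (z - y))\<^sup>2 / 2"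
    using closed_convex_minimizer_exists[OF \<open>closed C\<close> \<open>convex C\<close>] \<open>(z0, \<sigma> * r0) \<in> C\<close>
    by (metis empty_iff)
  have finite: "\<exists>r. conjugate f z = ereal r \<and> (z, \<sigma> * r) \<in> C" if "conjugate f z \<noteq> \<infinity>" for z
    using that conjugate_not_MInf[OF f(2), of z] \<sigma> by (cases "conjugate f z") (auto simp: C_def)
  have h_p0: "h p0 \<le> ereal (s0 + (norm (p0 - y))\<^sup>2 / 2)"
  proof -
    have "conjugate f p0 \<noteq> \<infinity>" using p0 by (auto simp: C_def)
    then obtain r where r: "conjugate f p0 = ereal r" using finite by blast
    then have "\<sigma> * r \<le> s0" using p0 \<sigma> by (simp add: C_def field_simps)
    then show ?thesis by (simp add: h_def r)
  qed
  have "is_arg_min h (\<lambda>_. True) p0"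
  proof -
    have "h p0 \<le> h z" for z
    proof (cases "conjugate f z = \<infinity>")
      case True
      then show ?thesis using \<sigma> by (simp add: h_def)
    next
      case False
      then obtain r where "conjugate f z = ereal r" "(z, \<sigma> * r) \<in> C" using finite by blast
      then show ?thesis
        using min0[of z "\<sigma> * r"] by (intro order_trans[OF h_p0]) (simp add: h_def)
    qed
    then show ?thesis by (simp add: is_arg_min_def not_less)
  qed
  then have "is_arg_min h (\<lambda>_. True) (arg_min h (\<lambda>_. True))"
    unfolding arg_min_def by (rule someI)
  moreover have "p = arg_min h (\<lambda>_. True)"
    by (simp add: p_def prox_def h_def)
  ultimately have p_min: "h p \<le> h z" for z
    by (simp add: is_arg_min_def not_less)
  have "h p < \<infinity>"
    using order_trans[OF p_min h_p0] by (auto simp: less_ereal.simps intro: le_less_trans)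
  then have "conjugate f p \<noteq> \<infinity>" using \<sigma> by (auto simp: h_def)
  then obtain s where s: "conjugate f p = ereal s" "(p, \<sigma> * s) \<in> C" using finite by blast
  have min: "\<sigma> * s + (norm (p - y))\<^sup>2 / 2 \<le> r + (norm (z - y))\<^sup>2 / 2" if "(z, r) \<in> C" for z r
  proof -
    have "conjugate f z \<noteq> \<infinity>" using that by (auto simp: C_def)
    then obtain b where b: "conjugate f z = ereal b" using finite by blast
    then have "\<sigma> * b \<le> r" using that \<sigma> by (simp add: C_def field_simps)
    then show ?thesis using p_min[of z] by (simp add: h_def s b)
  qed
  show thesis
  proof (rule that[OF s(1)])
    fix z r assume "conjugate f z = ereal r"
    then have "(z, \<sigma> * r) \<in> C" using \<sigma> by (simp add: C_def)
    with s(2) show "\<sigma> * s + (y - p) \<bullet> (z - p) \<le> \<sigma> * r"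
      by (rule minimizer_variational_inequality[OF \<open>convex C\<close>]) (rule min)
  qed
qed

section \<open>The ZM form and convergence of the gap\<close>

lemma bounded_linear_on_add:
  "bounded_linear_on S f \<Longrightarrow> u \<in> S \<Longrightarrow> v \<in> S \<Longrightarrow> f (u + v) = f u + f v"
  by (simp add: bounded_linear_on_def)

lemma bounded_linear_on_scaleR:
  "bounded_linear_on S f \<Longrightarrow> u \<in> S \<Longrightarrow> f (c *\<^sub>R u) = c *\<^sub>R f u"
  by (simp add: bounded_linear_on_def)

lemma bounded_linear_on_diff:
  assumes "bounded_linear_on S f" "subspace S" "u \<in> S" "v \<in> S"
  shows "f (u - v) = f u - f v"
  using bounded_linear_on_add[OF assms(1), of "u - v" v] assms(2-4) by (simp add: subspace_diff)

lemma bounded_linear_on_zero: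
  assumes "bounded_linear_on S f" "subspace S"
  shows "f 0 = 0"
  using bounded_linear_on_scaleR[OF assms(1) subspace_0[OF assms(2)], of 0] by simp

lemma bounded_linear_on_sum:
  assumes f: "bounded_linear_on S f" and S: "subspace S"
  shows "(\<And>i. i \<in> I \<Longrightarrow> u i \<in> S) \<Longrightarrow> f (\<Sum>i\<in>I. u i) = (\<Sum>i\<in>I. f (u i))"
proof (induction I rule: infinite_finite_induct)
  case (insert i I)
  then have "f (u i + (\<Sum>i\<in>I. u i)) = f (u i) + f (\<Sum>i\<in>I. u i)"
    using S by (intro bounded_linear_on_add[OF f] subspace_sum) auto
  with insert show ?case by simp
qed (simp_all add: bounded_linear_on_zero[OF f S])

lemma mass_sum: "mass (\<Sum>i\<in>I. \<mu> i) B = (\<Sum>i\<in>I. mass (\<mu> i) B)"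
  by (induction I rule: infinite_finite_induct) (simp_all add: mass_zero mass_add)

text \<open>The step length condition bounds the \<open>D\<close> term below by
  \<open>\<tau> * \<sigma> * (A \<nu> \<bullet> A \<nu>)\<close>, which completes the square of
  \<open>\<sigma> *\<^sub>R A \<nu> - q\<close> with weight
  \<open>\<tau> / \<sigma>\<close>.\<close>

lemma ZM_norm_sq_nonneg:
  assumes As: "pre_adjoint \<Omega> A As" and \<tau>: "0 < \<tau>" and \<sigma>: "0 < \<sigma>" and \<nu>: "\<nu> \<in> radon_on \<Omega>"
    and le: "\<tau> * \<sigma> * dual_prod (As (A \<nu>)) \<nu> \<le> dual_prod (D \<nu>) \<nu>"
  shows "0 \<le> ZM_norm_sq D A \<tau> \<sigma> (\<nu>, q)"
proof -
  have "dual_prod (As (A \<nu>)) \<nu> = A \<nu> \<bullet> A \<nu>"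
    using As \<nu> by (simp add: pre_adjoint_def)
  with le have "\<tau> * \<sigma> * (A \<nu> \<bullet> A \<nu>) \<le> dual_prod (D \<nu>) \<nu>" by simp
  moreover have "0 \<le> \<tau> / \<sigma> * (norm (\<sigma> *\<^sub>R A \<nu> - q))\<^sup>2"
    using \<tau> \<sigma> by simp
  then have "0 \<le> \<tau> * \<sigma> * (A \<nu> \<bullet> A \<nu>) - 2 * \<tau> * (A \<nu> \<bullet> q) + \<tau> / \<sigma> * (norm q)\<^sup>2"
    using \<sigma> unfolding power2_norm_eq_inner
    by (simp add: inner_diff inner_commute field_simps power2_eq_square)
  ultimately show ?thesis by (simp add: ZM_norm_sq_def)
qed

text \<open>Polarisation: the last bracket is the ZM inner product of \<open>(\<nu>, q)\<close> and
  \<open>(\<mu>, p)\<close>. The two cross terms of \<open>D\<close> merge because its pairing is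
  symmetric on \<open>radon_on \<Omega>\<close>.\<close>

lemma ZM_norm_sq_diff:
  assumes \<rho>: "\<rho> \<in> C0 UNIV" "\<And>x. \<rho> (- x) = \<rho> x" and \<Omega>: "\<Omega> \<in> sets borel"
    and A: "bounded_linear_on (radon_on \<Omega>) A"
    and \<mu>: "\<mu> \<in> radon_on \<Omega>" and \<nu>: "\<nu> \<in> radon_on \<Omega>"
  shows "ZM_norm_sq (conv_on \<Omega> \<rho>) A \<tau> \<sigma> (\<mu> - \<nu>, p - q) =
      ZM_norm_sq (conv_on \<Omega> \<rho>) A \<tau> \<sigma> (\<mu>, p) + ZM_norm_sq (conv_on \<Omega> \<rho>) A \<tau> \<sigma> (\<nu>, q)
      - 2 * (dual_prod (conv_on \<Omega> \<rho> \<nu>) \<mu> - \<tau> * (A \<nu> \<bullet> p) - \<tau> * (A \<mu> \<bullet> q) + \<tau> / \<sigma> * (q \<bullet> p))"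
proof -
  let ?D = "conv_on \<Omega> \<rho>"
  note bdd = bdd_borel_conv_on[OF \<rho>(1) \<Omega>]
  have "?D (\<mu> - \<nu>) = (\<lambda>x. ?D \<mu> x - ?D \<nu> x)"
    using conv_on_linear[OF \<rho>(1), of \<Omega> 1 \<mu> "-1" \<nu>] by simp
  then have "dual_prod (?D (\<mu> - \<nu>)) (\<mu> - \<nu>) =
      dual_prod (?D \<mu>) (\<mu> - \<nu>) - dual_prod (?D \<nu>) (\<mu> - \<nu>)"
    by (simp add: dual_prod_diff_left bdd)
  also have "\<dots> = dual_prod (?D \<mu>) \<mu> + dual_prod (?D \<nu>) \<nu> - 2 * dual_prod (?D \<nu>) \<mu>"
    using dual_prod_conv_on_commute[OF \<rho> \<Omega> \<mu> \<nu>] by (simp add: dual_prod_diff_right bdd)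
  finally have D: "dual_prod (?D (\<mu> - \<nu>)) (\<mu> - \<nu>) =
      dual_prod (?D \<mu>) \<mu> + dual_prod (?D \<nu>) \<nu> - 2 * dual_prod (?D \<nu>) \<mu>" .
  have A': "A (\<mu> - \<nu>) = A \<mu> - A \<nu>"
    by (rule bounded_linear_on_diff[OF A subspace_radon_on \<mu> \<nu>])
  have norm: "(norm (p - q))\<^sup>2 = (norm p)\<^sup>2 + (norm q)\<^sup>2 - 2 * (q \<bullet> p)"
    unfolding power2_norm_eq_inner by (simp add: inner_diff inner_commute)
  show ?thesis
    unfolding ZM_norm_sq_def prod.case D A' norm by (simp add: inner_diff algebra_simps)
qed

theorem theorem6p1:
  fixes \<Omega> :: "(real ^ 'n) set"
    and \<rho> :: "real ^ 'n \<Rightarrow> real"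
    and A :: "(real ^ 'n) radon \<Rightarrow> 'y :: {real_inner, complete_space}"
    and As :: "'y \<Rightarrow> real ^ 'n \<Rightarrow> real"
    and F0 :: "'y \<Rightarrow> ereal"
    and D :: "(real ^ 'n) radon \<Rightarrow> real ^ 'n \<Rightarrow> real"
    and G :: "(real ^ 'n) radon \<Rightarrow> ereal"
    and \<alpha> \<tau> \<sigma> \<kappa> :: real
    and \<epsilon> :: "nat \<Rightarrow> real"
    and \<mu>bar :: "(real ^ 'n) radon" and ybar :: 'y
    and \<mu> :: "nat \<Rightarrow> (real ^ 'n) radon" and y :: "nat \<Rightarrow> 'y"
    and utilde :: "nat \<Rightarrow> (real ^ 'n) radon \<times> 'y"
  assumes "compact \<Omega>"
    and "\<rho> \<in> C0 UNIV" and "\<exists>x. \<rho> x \<noteq> 0" and "\<And>x. \<rho> (- x) = \<rho> x" and "fourier_nonneg \<rho>"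
    and D_def: "D = conv_on \<Omega> \<rho>"
    and "bounded_linear_on (radon_on \<Omega>) A" and "pre_adjoint \<Omega> A As"
    and "convex_fun F0" and "proper_fun F0" and "lsc_fun F0"
    and "\<alpha> > 0" and G_def: "G = G_reg \<alpha>"
    and "\<mu>bar \<in> radon_on \<Omega>"
    and "((\<lambda>_. 0), 0) \<in> H_op \<Omega> G (conjugate F0) A As (\<mu>bar, ybar)"
    and "\<mu> 0 \<in> discrete_on \<Omega>"
    and "mu_PDPS \<Omega> D A As (conjugate F0) \<alpha> \<tau> \<sigma> \<kappa> \<epsilon> \<mu> y"
    and "0 < \<kappa>" and "\<kappa> < 1" and "\<tau> > 0" and "\<sigma> > 0"
    and "\<And>\<nu>. \<nu> \<in> radon_on \<Omega> \<Longrightarrow> \<tau> * \<sigma> * dual_prod (As (A \<nu>)) \<nu> \<le> dual_prod (D \<nu>) \<nu>"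
    and "\<And>k. \<epsilon> (Suc k) > 0"
    and "(\<lambda>N. (1 / real N) * (\<Sum>k<N. \<epsilon> (Suc k))) \<longlonglongrightarrow> 0"
    and utilde_def: "\<And>N. utilde N = (1 / real N) *\<^sub>R (\<Sum>k<N. (\<mu> (Suc k), y (Suc k)))"
  shows "(\<lambda>N. gap G (conjugate F0) A (utilde N) (\<mu>bar, ybar)) \<longlonglongrightarrow> 0 \<and>
    (\<forall>N\<ge>1. 0 \<le> gap G (conjugate F0) A (utilde N) (\<mu>bar, ybar) \<and>
       gap G (conjugate F0) A (utilde N) (\<mu>bar, ybar) \<le>
         ereal (1 / (real N * \<tau>) *
           ((\<kappa> + norm \<mu>bar) * (\<Sum>k<N. \<epsilon> (Suc k))
            + 1 / 2 * ZM_norm_sq D A \<tau> \<sigma> ((\<mu> 0, y 0) - (\<mu>bar, ybar)))))"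
proof -
  define R where "R = radon_on \<Omega>"
  \<comment> \<open>Total mass is linear and agrees with the norm on nonnegative measures, so values
    of \<open>G\<close> at the iterates average exactly.\<close>
  define m where "m = (\<lambda>\<nu> :: (real ^ 'n) radon. mass \<nu> UNIV)"
  define Z where "Z = (\<lambda>k. ZM_norm_sq D A \<tau> \<sigma> (\<mu> k - \<mu>bar, y k - ybar))"
  note \<rho> = \<open>\<rho> \<in> C0 UNIV\<close> \<open>\<And>x. \<rho> (- x) = \<rho> x\<close>
  note F0 = \<open>convex_fun F0\<close> \<open>proper_fun F0\<close> \<open>lsc_fun F0\<close>
  note A = \<open>bounded_linear_on (radon_on \<Omega>) A\<close>[folded R_def]
  note \<tau> = \<open>\<tau> > 0\<close> and \<sigma> = \<open>\<sigma> > 0\<close>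
  have \<Omega>: "closed \<Omega>" "\<Omega> \<in> sets borel"
    using \<open>compact \<Omega>\<close> by (auto intro: compact_imp_closed borel_closed)
  have R: "subspace R" unfolding R_def by (rule subspace_radon_on)
  note bar = \<open>\<mu>bar \<in> radon_on \<Omega>\<close>[folded R_def]

  \<comment> \<open>Pairings with the pre-adjoint\<close>
  have dual_As: "dual_prod (As z) \<nu> = A \<nu> \<bullet> z" if "\<nu> \<in> R" for \<nu> z
    using \<open>pre_adjoint \<Omega> A As\<close> that unfolding pre_adjoint_def R_def by blast
  have bdd_As: "bdd_borel (As z)" for z
    using \<open>pre_adjoint \<Omega> A As\<close> \<Omega>(1) unfolding pre_adjoint_def bounded_linear_C0_def
    by (blast intro: bdd_borel_C0)

  \<comment> \<open>Consequences of the inclusion at the solution\<close>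
  obtain \<phi> where \<phi>: "\<phi> \<in> pre_subdiff \<Omega> G \<mu>bar" "\<And>x. \<phi> x + As ybar x = 0"
    and A_bar: "A \<mu>bar \<in> subdiff (conjugate F0) ybar"
    using \<open>((\<lambda>_. 0), 0) \<in> H_op \<Omega> G (conjugate F0) A As (\<mu>bar, ybar)\<close>
    unfolding H_op_def by (auto simp: fun_eq_iff)
  have "\<phi> = (\<lambda>x. (-1) * As ybar x)"
    using \<phi>(2) by (simp add: fun_eq_iff eq_neg_iff_add_eq_0)
  then have dual_\<phi>: "dual_prod \<phi> \<nu> = - (A \<nu> \<bullet> ybar)" if "\<nu> \<in> R" for \<nu>
    using dual_prod_cmult_left[of "-1" "As ybar" \<nu>] dual_As[OF that] by simp
  have subgrad_G: "G \<mu>bar + ereal (- (A (\<nu> - \<mu>bar) \<bullet> ybar)) \<le> G \<nu>" if "\<nu> \<in> R" for \<nu>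
    using \<phi>(1) that bar R dual_\<phi>[of "\<nu> - \<mu>bar"]
    by (auto simp: pre_subdiff_def R_def subspace_diff)
  \<comment> \<open>\<open>G\<close> is finite at the zero measure, so the subgradient inequality
    there excludes an infinite \<open>G \<mu>bar\<close>.\<close>
  have nonneg_bar: "nonneg \<mu>bar"
  proof (rule ccontr)
    assume "\<not> nonneg \<mu>bar"
    then have "G \<mu>bar = \<infinity>" by (simp add: G_def G_reg_def)
    moreover have "G 0 = 0" by (simp add: G_def G_reg_def nonneg_def mass_zero)
    ultimately show False using subgrad_G[OF subspace_0[OF R]] by simp
  qed
  have G_nonneg: "G \<nu> = ereal (\<alpha> * m \<nu>)" if "nonneg \<nu>" for \<nu>
    using that by (simp add: G_def m_def G_reg_nonneg)
  have norm_bar: "norm \<mu>bar = m \<mu>bar"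
    unfolding m_def by (rule norm_nonneg_measure[OF nonneg_bar])

  have subgrad_F: "conjugate F0 ybar + ereal (A \<mu>bar \<bullet> (z - ybar)) \<le> conjugate F0 z" for z
    using A_bar by (simp add: subdiff_def)
  \<comment> \<open>Finiteness at \<open>ybar\<close> follows by testing its subgradient inequality
    at a point where the conjugate is finite.\<close>
  obtain sbar where sbar: "conjugate F0 ybar = ereal sbar"
  proof -
    obtain z r where "conjugate F0 z = ereal r"
      using proper_conjugate[OF F0] by (rule proper_funE)
    with subgrad_F[of z] have "conjugate F0 ybar \<noteq> \<infinity>" by auto
    with conjugate_not_MInf[OF F0(2), of ybar] that show thesis
      by (cases "conjugate F0 ybar") auto
  qed

  \<comment> \<open>The residual of the primal step\<close>
  define g where "g = (\<lambda>k x. \<tau> * (As (y k) x + \<alpha>) + D (\<mu> (Suc k) - \<mu> k) x)"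
  have iter: "\<mu> (Suc k) \<in> discrete_on \<Omega>" "nonneg (\<mu> (Suc k))"
    "\<And>x. x \<in> \<Omega> \<Longrightarrow> - \<epsilon> (Suc k) \<le> g k x"
    "dual_prod (g k) (\<mu> (Suc k)) \<le> \<kappa> * \<epsilon> (Suc k)"
    "y (Suc k) = prox (\<lambda>z. ereal \<sigma> * conjugate F0 z) (y k + \<sigma> *\<^sub>R A (2 *\<^sub>R \<mu> (Suc k) - \<mu> k))"
    for k
    using \<open>mu_PDPS \<Omega> D A As (conjugate F0) \<alpha> \<tau> \<sigma> \<kappa> \<epsilon> \<mu> y\<close>
    unfolding mu_PDPS_def g_def Let_def by blast+
  have \<mu>: "\<mu> k \<in> R" for k
  proof -
    have "\<mu> k \<in> discrete_on \<Omega>"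
      using iter(1) \<open>\<mu> 0 \<in> discrete_on \<Omega>\<close> by (cases k) auto
    then show ?thesis using discrete_on_subset_radon_on unfolding R_def by blast
  qed
  have bdd_D: "bdd_borel (D \<nu>)" for \<nu>
    unfolding D_def by (rule bdd_borel_conv_on[OF \<rho>(1) \<Omega>(2)])
  have bdd_affine: "bdd_borel (\<lambda>x. As (y k) x + \<alpha>)" for k
    by (intro bdd_borel_add bdd_As bdd_borel_const)
  have bdd_g: "bdd_borel (g k)" for k
    unfolding g_def by (intro bdd_borel_add bdd_borel_cmult bdd_affine bdd_D)
  have dual_g: "dual_prod (g k) \<nu> =
      \<tau> * (A \<nu> \<bullet> y k + \<alpha> * m \<nu>) + dual_prod (D (\<mu> (Suc k) - \<mu> k)) \<nu>"
    if "\<nu> \<in> R" for k \<nu>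
    unfolding g_def m_def
    by (simp add: dual_prod_add_left dual_prod_cmult_left dual_prod_const dual_As[OF that]
        bdd_borel_cmult bdd_affine bdd_D bdd_As bdd_borel_const)

  \<comment> \<open>The variational inequality of the dual step\<close>
  have "\<exists>s. conjugate F0 (y (Suc k)) = ereal s \<and>
      \<sigma> * s + (y k + \<sigma> *\<^sub>R A (2 *\<^sub>R \<mu> (Suc k) - \<mu> k) - y (Suc k)) \<bullet> (ybar - y (Suc k)) \<le> \<sigma> * sbar"
    for k
    by (rule prox_conjugate[OF F0 \<sigma> iter(5)]) (use sbar in blast)
  then obtain s where s: "\<And>k. conjugate F0 (y (Suc k)) = ereal (s k)"
    and prox_step: "\<And>k. \<sigma> * s k + (y k + \<sigma> *\<^sub>R A (2 *\<^sub>R \<mu> (Suc k) - \<mu> k) - y (Suc k)) \<bullet>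
        (ybar - y (Suc k)) \<le> \<sigma> * sbar"
    by metis

  \<comment> \<open>The one-step estimate for the gap\<close>
  define gap' where "gap' = (\<lambda>k. \<alpha> * m (\<mu> (Suc k)) - sbar + A (\<mu> (Suc k)) \<bullet> ybar
      - \<alpha> * m \<mu>bar + s k - A \<mu>bar \<bullet> y (Suc k))"
  have ZM_nonneg: "0 \<le> ZM_norm_sq D A \<tau> \<sigma> (\<nu>, q)" if "\<nu> \<in> R" for \<nu> q
    using ZM_norm_sq_nonneg[OF \<open>pre_adjoint \<Omega> A As\<close> \<tau> \<sigma>] that assms(22) unfolding R_def by blast
  have step: "\<tau> * gap' k \<le> (\<kappa> + norm \<mu>bar) * \<epsilon> (Suc k) + Z k / 2 - Z (Suc k) / 2" for k
  proof -
    let ?x = "\<mu> (Suc k)" and ?p = "\<mu> k" and ?q = "y (Suc k)" and ?w = "y k"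
    let ?d = "dual_prod (D (?x - ?p))"
    have diffs: "?x - ?p \<in> R" "?x - \<mu>bar \<in> R"
      using R \<mu> bar by (auto intro: subspace_diff)
    have A_diff: "A (\<nu> - \<xi>) = A \<nu> - A \<xi>" if "\<nu> \<in> R" "\<xi> \<in> R" for \<nu> \<xi>
      by (rule bounded_linear_on_diff[OF A R that])
    have A_extra: "A (2 *\<^sub>R ?x - ?p) = 2 *\<^sub>R A ?x - A ?p"
      using \<mu> R by (simp add: A_diff bounded_linear_on_scaleR[OF A] subspace_scale)
    have upper: "\<tau> * (A ?x \<bullet> ?w + \<alpha> * m ?x) + ?d ?x \<le> \<kappa> * \<epsilon> (Suc k)"
      using iter(4)[of k] dual_g[OF \<mu>] by simp
    have lower: "- \<epsilon> (Suc k) * m \<mu>bar \<le> \<tau> * (A \<mu>bar \<bullet> ?w + \<alpha> * m \<mu>bar) + ?d \<mu>bar"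
      using dual_prod_ge_on[OF nonneg_bar bar[unfolded R_def] \<Omega>(2) bdd_g iter(3)] dual_g[OF bar]
      by (simp add: m_def)
    \<comment> \<open>The factor \<open>\<tau> / \<sigma>\<close> gives the dual step the weight
      that the dual variable has in the ZM form.\<close>
    have "\<tau> / \<sigma> * (\<sigma> * s k + (?w + \<sigma> *\<^sub>R A (2 *\<^sub>R ?x - ?p) - ?q) \<bullet> (ybar - ?q)) \<le> \<tau> / \<sigma> * (\<sigma> * sbar)"
      using prox_step[of k] \<tau> \<sigma> by (intro mult_left_mono) auto
    moreover have "(?w + \<sigma> *\<^sub>R A (2 *\<^sub>R ?x - ?p) - ?q) \<bullet> (ybar - ?q) =
        (?q - ?w) \<bullet> (?q - ybar) - \<sigma> * ((2 *\<^sub>R A ?x - A ?p) \<bullet> (?q - ybar))"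
      unfolding A_extra by (simp add: inner_diff inner_add algebra_simps)
    ultimately have "\<tau> / \<sigma> * (\<sigma> * s k + ((?q - ?w) \<bullet> (?q - ybar)
        - \<sigma> * ((2 *\<^sub>R A ?x - A ?p) \<bullet> (?q - ybar)))) \<le> \<tau> / \<sigma> * (\<sigma> * sbar)"
      by simp
    then have dual: "\<tau> * s k + \<tau> / \<sigma> * ((?q - ?w) \<bullet> (?q - ybar))
        - \<tau> * ((2 *\<^sub>R A ?x - A ?p) \<bullet> (?q - ybar)) \<le> \<tau> * sbar"
      using \<sigma> by (simp add: distrib_left right_diff_distrib)
    \<comment> \<open>The error at \<open>k\<close> is the error at \<open>Suc k\<close> minus the
      increment. The squared increment from polarisation is nonnegative and is dropped.\<close>
    have "Z k = ZM_norm_sq D A \<tau> \<sigma> ((?x - \<mu>bar) - (?x - ?p), (?q - ybar) - (?q - ?w))"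
      by (simp add: Z_def)
    also have "\<dots> = Z (Suc k) + ZM_norm_sq D A \<tau> \<sigma> (?x - ?p, ?q - ?w)
        - 2 * (?d (?x - \<mu>bar) - \<tau> * (A (?x - ?p) \<bullet> (?q - ybar)) - \<tau> * (A (?x - \<mu>bar) \<bullet> (?q - ?w))
          + \<tau> / \<sigma> * ((?q - ?w) \<bullet> (?q - ybar)))"
      using ZM_norm_sq_diff[OF \<rho> \<Omega>(2) A[unfolded R_def]] diffs unfolding D_def R_def Z_def by blast
    finally have "Z (Suc k) / 2 - Z k / 2 \<le> ?d (?x - \<mu>bar) - \<tau> * (A (?x - ?p) \<bullet> (?q - ybar))
        - \<tau> * (A (?x - \<mu>bar) \<bullet> (?q - ?w)) + \<tau> / \<sigma> * ((?q - ?w) \<bullet> (?q - ybar))"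
      using ZM_nonneg[OF diffs(1), of "?q - ?w"] by argo
    also have "?d (?x - \<mu>bar) = ?d ?x - ?d \<mu>bar"
      by (rule dual_prod_diff_right[OF bdd_D])
    finally have three_point: "Z (Suc k) / 2 - Z k / 2 \<le> ?d ?x - ?d \<mu>bar
        - \<tau> * ((A ?x - A ?p) \<bullet> (?q - ybar)) - \<tau> * ((A ?x - A \<mu>bar) \<bullet> (?q - ?w))
        + \<tau> / \<sigma> * ((?q - ?w) \<bullet> (?q - ybar))"
      using \<mu> bar by (simp add: A_diff)
    \<comment> \<open>The primal residual couples with the old dual iterate \<open>?w\<close>. Once
      \<open>upper\<close>, \<open>lower\<close> and \<open>dual\<close> are inserted, the remaining
      couplings are \<open>\<tau> * ((A ?x - A ?p) \<bullet> (?q - ybar))\<close> and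
      \<open>\<tau> * ((A ?x - A \<mu>bar) \<bullet> (?q - ?w))\<close>, as in
      \<open>three_point\<close>; the extrapolation \<open>2 *\<^sub>R ?x - ?p\<close> is what
      produces this match.\<close>
    have "\<tau> * gap' k + \<tau> * (A ?x \<bullet> ?w) - \<tau> * (A \<mu>bar \<bullet> ?w) =
        \<tau> * (A ?x \<bullet> ?w + \<alpha> * m ?x) - \<tau> * (A \<mu>bar \<bullet> ?w + \<alpha> * m \<mu>bar)
        + \<tau> * s k - \<tau> * sbar + \<tau> * (A ?x \<bullet> ybar) - \<tau> * (A \<mu>bar \<bullet> ?q)"
      by (simp add: gap'_def algebra_simps)
    with upper lower dual three_point show ?thesis
      unfolding norm_bar by (simp add: inner_diff algebra_simps)
  qed

  \<comment> \<open>Bounds for the averaged iterates\<close>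
  define Cst where "Cst = (\<lambda>N. 1 / (real N * \<tau>) * ((\<kappa> + norm \<mu>bar) * (\<Sum>k<N. \<epsilon> (Suc k)) + 1 / 2 * Z 0))"
  have bounds: "0 \<le> gap G (conjugate F0) A (utilde N) (\<mu>bar, ybar) \<and>
      gap G (conjugate F0) A (utilde N) (\<mu>bar, ybar) \<le> ereal (Cst N)" if N: "N \<ge> 1" for N
  proof -
    define x where "x = (1 / real N) *\<^sub>R (\<Sum>k<N. \<mu> (Suc k))"
    define q where "q = (1 / real N) *\<^sub>R (\<Sum>k<N. y (Suc k))"
    have u: "utilde N = (x, q)"
      unfolding utilde_def x_def q_def by (simp add: sum_prod)
    have sum_R: "(\<Sum>k<N. \<mu> (Suc k)) \<in> R"
      using R \<mu> by (intro subspace_sum) auto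
    then have x_R: "x \<in> R" unfolding x_def using R by (simp add: subspace_scale)
    have nonneg_x: "nonneg x"
      unfolding x_def using iter(2) by (intro nonneg_scaleR nonneg_sum) auto
    have A_x: "A x = (1 / real N) *\<^sub>R (\<Sum>k<N. A (\<mu> (Suc k)))"
      unfolding x_def using sum_R \<mu>
      by (simp add: bounded_linear_on_scaleR[OF A] bounded_linear_on_sum[OF A R])
    have m_x: "m x = (1 / real N) * (\<Sum>k<N. m (\<mu> (Suc k)))"
      unfolding x_def m_def by (simp add: mass_scaleR mass_sum)
    \<comment> \<open>Besides the estimate, Jensen's inequality shows that the conjugate is finite
      at \<open>q\<close>, so the gap is a real number.\<close>
    have "conjugate F0 q \<le> ereal ((1 / real N) * (\<Sum>k<N. s k))"
      unfolding q_def using N s by (intro conjugate_average_le[OF F0(2)]) auto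
    moreover from this obtain t where t: "conjugate F0 q = ereal t"
      using conjugate_not_MInf[OF F0(2), of q] by (cases "conjugate F0 q") auto
    ultimately have t_le: "t \<le> (1 / real N) * (\<Sum>k<N. s k)" by simp
    have gap_eq: "gap G (conjugate F0) A (utilde N) (\<mu>bar, ybar) =
        ereal (\<alpha> * m x - sbar + A x \<bullet> ybar - \<alpha> * m \<mu>bar + t - A \<mu>bar \<bullet> q)"
      unfolding u gap_def by (simp add: G_nonneg nonneg_x nonneg_bar sbar t)
    \<comment> \<open>The two subgradient inequalities at the solution add up to the lower bound;
      the terms \<open>A \<mu>bar \<bullet> ybar\<close> cancel.\<close>
    have "\<alpha> * m \<mu>bar - (A x - A \<mu>bar) \<bullet> ybar \<le> \<alpha> * m x"
      using subgrad_G[OF x_R] bounded_linear_on_diff[OF A R x_R bar]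
      by (simp add: G_nonneg nonneg_x nonneg_bar)
    moreover have "sbar + A \<mu>bar \<bullet> (q - ybar) \<le> t"
      using subgrad_F[of q] by (simp add: sbar t)
    ultimately have "0 \<le> \<alpha> * m x - sbar + A x \<bullet> ybar - \<alpha> * m \<mu>bar + t - A \<mu>bar \<bullet> q"
      by (simp add: inner_diff)
    moreover have "\<alpha> * m x - sbar + A x \<bullet> ybar - \<alpha> * m \<mu>bar + t - A \<mu>bar \<bullet> q \<le> Cst N"
    proof -
      \<comment> \<open>Only the conjugate value \<open>t\<close> is estimated; every other term is
        affine in the iterates and equals its average.\<close>
      have "\<alpha> * m x - sbar + A x \<bullet> ybar - \<alpha> * m \<mu>bar + t - A \<mu>bar \<bullet> q
          \<le> (1 / real N) * (\<Sum>k<N. gap' k)"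
        using t_le N unfolding gap'_def m_x A_x q_def
        by (simp add: sum.distrib sum_subtractf inner_sum_left inner_sum_right sum_distrib_left[symmetric]
            field_simps)
      also have "\<dots> = 1 / (real N * \<tau>) * (\<Sum>k<N. \<tau> * gap' k)"
        using \<tau> by (simp add: sum_distrib_left[symmetric])
      also have "\<dots> \<le> 1 / (real N * \<tau>) *
          (\<Sum>k<N. (\<kappa> + norm \<mu>bar) * \<epsilon> (Suc k) + (Z k / 2 - Z (Suc k) / 2))"
        using step \<tau> by (intro mult_left_mono sum_mono) (auto simp: algebra_simps)
      also have "\<dots> = 1 / (real N * \<tau>) *
          ((\<kappa> + norm \<mu>bar) * (\<Sum>k<N. \<epsilon> (Suc k)) + (Z 0 / 2 - Z N / 2))"
        by (simp only: sum.distrib sum_distrib_left[symmetric]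
            sum_lessThan_telescope'[of "\<lambda>k. Z k / 2"])
      also have "\<dots> \<le> Cst N"
      proof -
        have "0 \<le> Z N"
          unfolding Z_def using ZM_nonneg R \<mu> bar by (auto intro: subspace_diff)
        then show ?thesis
          unfolding Cst_def using \<tau> by (intro mult_left_mono) auto
      qed
      finally show ?thesis .
    qed
    ultimately show ?thesis unfolding gap_eq by simp
  qed

  \<comment> \<open>The limit\<close>
  have "Cst = (\<lambda>N. 1 / \<tau> * ((\<kappa> + norm \<mu>bar) * (1 / real N * (\<Sum>k<N. \<epsilon> (Suc k)))
      + 1 / 2 * Z 0 * (1 / real N)))"
    unfolding Cst_def by (simp add: fun_eq_iff add_divide_distrib distrib_left mult.commute)
  moreover have "(\<lambda>N. 1 / \<tau> * ((\<kappa> + norm \<mu>bar) * (1 / real N * (\<Sum>k<N. \<epsilon> (Suc k)))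
      + 1 / 2 * Z 0 * (1 / real N))) \<longlonglongrightarrow> 1 / \<tau> * ((\<kappa> + norm \<mu>bar) * 0 + 1 / 2 * Z 0 * 0)"
    by (intro tendsto_intros assms(24) lim_1_over_n)
  ultimately have "(\<lambda>N. ereal (Cst N)) \<longlonglongrightarrow> ereal 0"
    by (intro tendsto_ereal) simp
  then have lim: "(\<lambda>N. ereal (Cst N)) \<longlonglongrightarrow> 0" by (simp add: zero_ereal_def)
  \<comment> \<open>At \<open>N = 0\<close> the average takes the default value zero, for which
    \<open>bounds\<close> says nothing, so the comparison starts at 1.\<close>
  have "(\<lambda>N. gap G (conjugate F0) A (utilde N) (\<mu>bar, ybar)) \<longlonglongrightarrow> 0"
    by (rule tendsto_sandwich[OF _ _ tendsto_const lim])
      (use bounds in \<open>auto intro!: eventually_sequentiallyI[of 1]\<close>)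
  then show ?thesis
    using bounds unfolding Cst_def Z_def by simp
qed

end
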